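(* Let $(\varPhi,\overline{y})$ be a relatively normalized skew ruled surface in $\mathbb{E}^3$ with fundamental invariants $\delta,\kappa,\lambda$ and support function $q$. Then the Pick invariant $J$, the relative mean curvature $H$ and the scalar curvature $S$ of the relative metric are given by $$J=\frac{3\,(w^2q_{/2}+vq)}{2\delta^2w^3q}\Big\{w^2\big[\kappa qv+2\delta q_{/1}+q_{/2}(\kappa w^2+\delta'v-\delta^2\lambda)\big]-\delta^2q(\lambda v-\delta')\Big\},$$ $$H=\frac{1}{2\delta^2w^3}\Big\{-\delta^2q(\kappa w^2+\delta'v+\delta^2\lambda)+2w^2q_{/2}\big[(2\kappa v+\delta')w^2-\delta^2\lambda v\big]+w^4q_{/22}(\kappa w^2+\delta'v-\delta^2\lambda)+2\delta vw^2q_{/1}+2\delta w^4q_{/12}\Big\},$$ $$S=\frac{1}{2\delta^2w^3q}\Big\{q^2\big[-\kappa w^4+\delta^2(\lambda v^2-2\delta'v-\delta^2\lambda)\big]+w^4qq_{/2}(2\kappa v+\delta')+w^4(\kappa w^2+\delta'v-\delta^2\lambda)(qq_{/22}-q_{/2}^2)-2\delta w^4q_{/1}q_{/2}+2\delta w^4qq_{/12}\Big\}.$$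
   Context: Ruled surface: $\varPhi$ is a $C^r$ ruled surface ($r\ge3$) of nowhere vanishing Gaussian curvature in $\mathbb{E}^3$, parametrized by $\overline{x}(u,v)=\overline{s}(u)+v\,\overline{e}(u)$ on $U=I\times\mathbb{R}$ ($I$ an open interval), with $|\overline{e}|=|\overline{e}'|=1$, $\langle\overline{s}',\overline{e}'\rangle=0$ (prime $=d/du$). Put $\overline{n}=\overline{e}'$, $\overline{z}=\overline{e}\times\overline{n}$, $\delta=(\overline{s}',\overline{e},\overline{e}')$ (nowhere zero), $\kappa=(\overline{e},\overline{e}',\overline{e}'')$, and let $\lambda=\lambda(u)$ be defined by $\overline{s}'=\delta\lambda\,\overline{e}+\delta\,\overline{z}$. Then $\overline{e}'=\overline{n}$, $\overline{n}'=-\overline{e}+\kappa\overline{z}$, $\overline{z}'=-\kappa\overline{n}$. Put $w=\sqrt{\delta^2+v^2}$; the unit normal is $\overline{\xi}=(\delta\overline{n}-v\overline{z})/w$; $h_{ij}$ are the coefficients of the second fundamental form with respect to $\overline{\xi}$: $h_{11}=-(\kappa w^2+\delta'v-\delta^2\lambda)/w$, $h_{12}=\delta/w$, $h_{22}=0$. Write $u^1=u,u^2=v$, $f_{/i}=\partial f/\partial u^i$, $f_{/ij}=\partial^2f/\partial u^i\partial u^j$. All functions are differentiable as often as required. Relative normalization: a map $\overline{y}$ on $U$ with $\overline{x}_{/1},\overline{x}_{/2},\overline{y}$ linearly independent and $\overline{y}_{/1},\overline{y}_{/2}$ in the span of $\overline{x}_{/1},\overline{x}_{/2}$. Support function: $q=\langle\overline{\xi},\overline{y}\rangle$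 (nowhere zero); it determines $\overline{y}=y_1\overline{e}+y_2\overline{n}+y_3\overline{z}$ with $y_1=-w\frac{\delta q_{/1}+q_{/2}(\kappa w^2+\delta'v)}{\delta^2}$, $y_2=\frac{\delta^2q-w^2vq_{/2}}{\delta w}$, $y_3=-\frac{vq+w^2q_{/2}}{w}$. Relative metric: $G_{ij}=h_{ij}/q$ (indefinite), with covariant derivative $\nabla^G$. Darboux tensor: $A_{ijk}=\frac1q\langle\overline{\xi},\nabla^G_k\nabla^G_j\overline{x}_{/i}\rangle$; Pick invariant $J=\frac12A_{ijk}A^{ijk}$ (indices raised with $G$). Relative shape operator: $\overline{y}_{/i}=-B_i^j\overline{x}_{/j}$; $H=\frac12(B_1^1+B_2^2)$. $S$ is the curvature of the pseudo-Riemannian surface with metric $G$, normalized as Gaussian curvature, $S=R_{1212}/\det(G_{ij})$ (positive for round spheres in the Riemannian case). *)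

theory Defs
  imports "HOL-Analysis.Analysis"
begin

unbundle no cross3_syntax

text \<open>
  The coordinate indices range over the two-element type \<open>2\<close>, so that sums over an index are sums
  over \<open>UNIV\<close>; the index values are \<open>1\<close> and \<open>2\<close> (which is \<open>0\<close> in that type).
\<close>

definition pd :: "2 \<Rightarrow> (real \<Rightarrow> real \<Rightarrow> 'a::real_normed_vector) \<Rightarrow> real \<Rightarrow> real \<Rightarrow> 'a" where
  "pd i f u v = (if i = 1 then vector_derivative (\<lambda>t. f t v) (at u)
                          else vector_derivative (\<lambda>t. f u t) (at v))"

definition has_pd :: "2 \<Rightarrow> (real \<Rightarrow> real \<Rightarrow> 'a::real_normed_vector) \<Rightarrow> real \<Rightarrow> real \<Rightarrow> bool" where
  "has_pd i f u v \<longleftrightarrow> (if i = 1 then (\<lambda>t. f t v) differentiable (at u)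
                             else (\<lambda>t. f u t) differentiable (at v))"

text \<open>Class \<open>C\<^sup>k\<close> on an open set of reals, and class \<open>C\<^sup>1\<close> on an open set of the plane.\<close>

fun Ck_on :: "nat \<Rightarrow> (real \<Rightarrow> 'a::real_normed_vector) \<Rightarrow> real set \<Rightarrow> bool" where
  "Ck_on 0 f I \<longleftrightarrow> continuous_on I f"
| "Ck_on (Suc k) f I \<longleftrightarrow>
     (\<forall>t\<in>I. f differentiable (at t)) \<and> Ck_on k (\<lambda>t. vector_derivative f (at t)) I"

definition C1_plane_on :: "(real \<Rightarrow> real \<Rightarrow> 'a::real_normed_vector) \<Rightarrow> (real \<times> real) set \<Rightarrow> bool" where
  "C1_plane_on f U \<longleftrightarrow>
     (\<forall>i. (\<forall>(u, v)\<in>U. has_pd i f u v) \<and> continuous_on U (\<lambda>(u, v). pd i f u v))"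


section \<open>Surfaces in Euclidean space\<close>

type_synonym surface = "real \<Rightarrow> real \<Rightarrow> real^3"

definition unit_normal :: "surface \<Rightarrow> real \<Rightarrow> real \<Rightarrow> real^3" where
  "unit_normal x u v = sgn (cross3 (pd 1 x u v) (pd 2 x u v))"

definition first_ff :: "surface \<Rightarrow> real \<Rightarrow> real \<Rightarrow> real^2^2" where
  "first_ff x u v = (\<chi> i j. pd i x u v \<bullet> pd j x u v)"

definition second_ff :: "surface \<Rightarrow> real \<Rightarrow> real \<Rightarrow> real^2^2" where
  "second_ff x u v = (\<chi> i j. unit_normal x u v \<bullet> pd i (pd j x) u v)"

definition gaussian_curvature :: "surface \<Rightarrow> real \<Rightarrow> real \<Rightarrow> real" where
  "gaussian_curvature x u v = det (second_ff x u v) / det (first_ff x u v)"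


section \<open>Pseudo-Riemannian metrics in two coordinates\<close>

type_synonym metric = "real \<Rightarrow> real \<Rightarrow> real^2^2"

text \<open>\<open>christoffel G k i j\<close> is \<open>\<Gamma>\<close> with upper index \<open>k\<close> and lower indices \<open>i\<close>, \<open>j\<close>.\<close>

definition christoffel :: "metric \<Rightarrow> 2 \<Rightarrow> 2 \<Rightarrow> 2 \<Rightarrow> real \<Rightarrow> real \<Rightarrow> real" where
  "christoffel G k i j u v =
     (1/2) * (\<Sum>l\<in>UNIV. matrix_inv (G u v) $ k $ l *
        (pd i (\<lambda>u v. G u v $ j $ l) u v + pd j (\<lambda>u v. G u v $ i $ l) u v
           - pd l (\<lambda>u v. G u v $ i $ j) u v))"

text \<open>
  Covariant derivative of a (vector-valued) covariant tensor of rank one and of rank two; the first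
  index of the result is the direction of differentiation.
\<close>

definition cov_deriv1 ::
  "metric \<Rightarrow> (2 \<Rightarrow> real \<Rightarrow> real \<Rightarrow> 'a::real_normed_vector) \<Rightarrow> 2 \<Rightarrow> 2 \<Rightarrow> real \<Rightarrow> real \<Rightarrow> 'a" where
  "cov_deriv1 G \<omega> j i u v = pd j (\<omega> i) u v - (\<Sum>m\<in>UNIV. christoffel G m j i u v *\<^sub>R \<omega> m u v)"

definition cov_deriv2 ::
  "metric \<Rightarrow> (2 \<Rightarrow> 2 \<Rightarrow> real \<Rightarrow> real \<Rightarrow> 'a::real_normed_vector) \<Rightarrow>
     2 \<Rightarrow> 2 \<Rightarrow> 2 \<Rightarrow> real \<Rightarrow> real \<Rightarrow> 'a" where
  "cov_deriv2 G T k j i u v = pd k (T j i) u v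
     - (\<Sum>m\<in>UNIV. christoffel G m k j u v *\<^sub>R T m i u v)
     - (\<Sum>m\<in>UNIV. christoffel G m k i u v *\<^sub>R T j m u v)"

text \<open>
  \<open>riemann_up G l k i j\<close> is the \<open>l\<close>-th component of \<open>R(\<partial>\<^sub>i, \<partial>\<^sub>j)\<partial>\<^sub>k\<close>; with this sign convention
  \<open>R\<^sub>1\<^sub>2\<^sub>1\<^sub>2 / det G\<close> is positive on round spheres.
\<close>

definition riemann_up :: "metric \<Rightarrow> 2 \<Rightarrow> 2 \<Rightarrow> 2 \<Rightarrow> 2 \<Rightarrow> real \<Rightarrow> real \<Rightarrow> real" where
  "riemann_up G l k i j u v =
     pd i (christoffel G l j k) u v - pd j (christoffel G l i k) u v
     + (\<Sum>m\<in>UNIV. christoffel G l i m u v * christoffel G m j k u v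
                 - christoffel G l j m u v * christoffel G m i k u v)"

definition riemann :: "metric \<Rightarrow> 2 \<Rightarrow> 2 \<Rightarrow> 2 \<Rightarrow> 2 \<Rightarrow> real \<Rightarrow> real \<Rightarrow> real" where
  "riemann G l k i j u v = (\<Sum>m\<in>UNIV. G u v $ l $ m * riemann_up G m k i j u v)"

definition metric_curvature :: "metric \<Rightarrow> real \<Rightarrow> real \<Rightarrow> real" where
  "metric_curvature G u v = riemann G 1 2 1 2 u v / det (G u v)"


section \<open>Relative normalizations\<close>

definition relative_normalization :: "(real \<times> real) set \<Rightarrow> surface \<Rightarrow> surface \<Rightarrow> bool" where
  "relative_normalization U x y \<longleftrightarrow>
     C1_plane_on y U \<and>
     (\<forall>(u, v)\<in>U.
        (\<forall>a b c. a *\<^sub>R pd 1 x u v + b *\<^sub>R pd 2 x u v + c *\<^sub>R y u v = 0 \<longrightarrow>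
                 a = 0 \<and> b = 0 \<and> c = 0) \<and>
        (\<forall>i. pd i y u v \<in> span {pd 1 x u v, pd 2 x u v}))"

definition support_function :: "surface \<Rightarrow> surface \<Rightarrow> real \<Rightarrow> real \<Rightarrow> real" where
  "support_function x y u v = unit_normal x u v \<bullet> y u v"

definition relative_metric :: "surface \<Rightarrow> surface \<Rightarrow> metric" where
  "relative_metric x y u v = (\<chi> i j. second_ff x u v $ i $ j / support_function x y u v)"

definition darboux_tensor :: "surface \<Rightarrow> surface \<Rightarrow> 2 \<Rightarrow> 2 \<Rightarrow> 2 \<Rightarrow> real \<Rightarrow> real \<Rightarrow> real" where
  "darboux_tensor x y i j k u v =
     (1 / support_function x y u v) *
     (unit_normal x u v \<bullet>
        cov_deriv2 (relative_metric x y)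
          (cov_deriv1 (relative_metric x y) (\<lambda>i. pd i x)) k j i u v)"

definition pick_invariant :: "surface \<Rightarrow> surface \<Rightarrow> real \<Rightarrow> real \<Rightarrow> real" where
  "pick_invariant x y u v =
     (let Ginv = matrix_inv (relative_metric x y u v); A = darboux_tensor x y in
      (1/2) * (\<Sum>i\<in>UNIV. \<Sum>j\<in>UNIV. \<Sum>k\<in>UNIV. A i j k u v *
                 (\<Sum>l\<in>UNIV. \<Sum>m\<in>UNIV. \<Sum>n\<in>UNIV.
                    Ginv $ i $ l * Ginv $ j $ m * Ginv $ k $ n * A l m n u v)))"

text \<open>The entry \<open>B $ i $ j\<close> is \<open>B\<close> with lower index \<open>i\<close> and upper index \<open>j\<close>.\<close>

definition relative_shape_operator :: "surface \<Rightarrow> surface \<Rightarrow> real \<Rightarrow> real \<Rightarrow> real^2^2" where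
  "relative_shape_operator x y u v =
     (THE B. \<forall>i. pd i y u v = - (\<Sum>j\<in>UNIV. B $ i $ j *\<^sub>R pd j x u v))"

definition relative_mean_curvature :: "surface \<Rightarrow> surface \<Rightarrow> real \<Rightarrow> real \<Rightarrow> real" where
  "relative_mean_curvature x y u v =
     (1/2) * (relative_shape_operator x y u v $ 1 $ 1 + relative_shape_operator x y u v $ 2 $ 2)"

definition relative_metric_curvature :: "surface \<Rightarrow> surface \<Rightarrow> real \<Rightarrow> real \<Rightarrow> real" where
  "relative_metric_curvature x y = metric_curvature (relative_metric x y)"


section \<open>Skew ruled surfaces\<close>

abbreviation curve_deriv :: "(real \<Rightarrow> real^3) \<Rightarrow> real \<Rightarrow> real^3" where
  "curve_deriv c u \<equiv> vector_derivative c (at u)"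

definition ruled_surface :: "(real \<Rightarrow> real^3) \<Rightarrow> (real \<Rightarrow> real^3) \<Rightarrow> surface" where
  "ruled_surface s e u v = s u + v *\<^sub>R e u"

text \<open>
  Class \<open>C\<^sup>4\<close> is what the objects below need: the relative metric contains second derivatives of the
  surface, and its curvature and the Darboux tensor differentiate the metric twice.
  Non-vanishing Gaussian curvature includes regularity of the parametrization, because
  \<open>gaussian_curvature\<close> is \<open>0\<close> where the first fundamental form is degenerate.
\<close>

definition skew_ruled_surface :: "real set \<Rightarrow> (real \<Rightarrow> real^3) \<Rightarrow> (real \<Rightarrow> real^3) \<Rightarrow> bool" where
  "skew_ruled_surface I s e \<longleftrightarrow>
     open I \<and> is_interval I \<and> Ck_on 4 s I \<and> Ck_on 4 e I \<and>
     (\<forall>u\<in>I. norm (e u) = 1 \<and> norm (curve_deriv e u) = 1 \<and>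
            curve_deriv s u \<bullet> curve_deriv e u = 0) \<and>
     (\<forall>u\<in>I. \<forall>v. gaussian_curvature (ruled_surface s e) u v \<noteq> 0)"

definition triple_product :: "real^3 \<Rightarrow> real^3 \<Rightarrow> real^3 \<Rightarrow> real" where
  "triple_product a b c = a \<bullet> cross3 b c"

definition ruled_delta :: "(real \<Rightarrow> real^3) \<Rightarrow> (real \<Rightarrow> real^3) \<Rightarrow> real \<Rightarrow> real" where
  "ruled_delta s e u = triple_product (curve_deriv s u) (e u) (curve_deriv e u)"

definition ruled_kappa :: "(real \<Rightarrow> real^3) \<Rightarrow> real \<Rightarrow> real" where
  "ruled_kappa e u = triple_product (e u) (curve_deriv e u) (curve_deriv (curve_deriv e) u)"

text \<open>The third invariant is characterized by \<open>s' = \<delta> \<Lambda> e + \<delta> z\<close> with \<open>z = e \<times> e'\<close>.\<close>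

definition is_ruled_lambda ::
  "real set \<Rightarrow> (real \<Rightarrow> real^3) \<Rightarrow> (real \<Rightarrow> real^3) \<Rightarrow> (real \<Rightarrow> real) \<Rightarrow> bool" where
  "is_ruled_lambda I s e \<Lambda> \<longleftrightarrow>
     (\<forall>u\<in>I. curve_deriv s u =
        (ruled_delta s e u * \<Lambda> u) *\<^sub>R e u + ruled_delta s e u *\<^sub>R cross3 (e u) (curve_deriv e u))"

end

theory Submission
  imports Defs
begin

text \<open>
  The vector \<open>N = x\<^sub>1 \<times> x\<^sub>2 = \<delta> n - v z\<close> equals \<open>w \<xi>\<close>, and tangency of \<open>y\<^sub>i\<close> means \<open>N \<bullet> y\<^sub>i = 0\<close>. Hence, with
  \<open>p = N \<bullet> y = w q\<close>, the relative metric is \<open>(w h\<^sub>i\<^sub>j) / p\<close>, where \<open>w h\<^sub>i\<^sub>j\<close> is polynomial in \<open>v\<close>, and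
  \<open>p\<^sub>i = N\<^sub>i \<bullet> y\<close>, so that \<open>p\<close> is twice differentiable although \<open>y\<close> is only of class \<open>C\<^sup>1\<close>.
  As \<open>G\<^sub>2\<^sub>2 = 0\<close>, most Christoffel symbols vanish, the curvature reduces to a single difference of
  derivatives, and \<open>A\<^sub>2\<^sub>2\<^sub>2 = 0\<close> removes \<open>A\<^sub>1\<^sub>1\<^sub>1\<close> from the Pick invariant. The mean curvature needs
  \<open>p\<^sub>1\<^sub>2 = p\<^sub>2\<^sub>1\<close>. Rewriting the three results from \<open>p\<close> to \<open>q\<close> gives the formulas.
\<close>

section \<open>Partial derivatives\<close>

lemma pd_1_eqI:
  assumes "open I" "u \<in> I" "\<And>t. t \<in> I \<Longrightarrow> f t v = g t"
    and "(g has_vector_derivative D) (at u)"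
  shows "pd 1 f u v = D"
proof -
  have "((\<lambda>t. f t v) has_vector_derivative D) (at u)"
    by (rule has_vector_derivative_transform_within_open[OF assms(4,1,2)]) (simp add: assms(3))
  then show ?thesis
    by (simp add: pd_def vector_derivative_at)
qed

lemma pd_2_eqI:
  assumes "\<And>t. f u t = g t" and "(g has_vector_derivative D) (at v)"
  shows "pd 2 f u v = D"
proof -
  have "f u = g" using assms(1) by blast
  then show ?thesis using assms(2) by (simp add: pd_def vector_derivative_at)
qed

lemmas pd_1_real_eqI = pd_1_eqI[OF _ _ _ has_real_derivative_iff_has_vector_derivative[THEN iffD1]]
lemmas pd_2_real_eqI = pd_2_eqI[OF _ has_real_derivative_iff_has_vector_derivative[THEN iffD1]]

lemma has_pd_1D: "has_pd 1 f u v \<Longrightarrow> ((\<lambda>t. f t v) has_vector_derivative pd 1 f u v) (at u)"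
  by (simp add: has_pd_def pd_def vector_derivative_works)

lemma has_pd_2D: "has_pd 2 f u v \<Longrightarrow> ((\<lambda>t. f u t) has_vector_derivative pd 2 f u v) (at v)"
  by (simp add: has_pd_def pd_def vector_derivative_works)

text \<open>\<open>C1_plane_on\<close> speaks of the partial derivatives only. Existence of one and
  joint continuity of the other give total differentiability, hence continuity; the continuity of
  \<open>p12\<close> below relies on this for \<open>y\<close>.\<close>

lemma C1_plane_on_imp_continuous_on:
  fixes f :: "real \<Rightarrow> real \<Rightarrow> 'a::real_normed_vector"
  assumes f: "C1_plane_on f (I \<times> UNIV)" and I: "open I"
  shows "continuous_on (I \<times> UNIV) (\<lambda>(u, v). f u v)"
proof (clarsimp simp: continuous_on_eq_continuous_within)
  fix u v assume u: "u \<in> I"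
  have pd: "has_pd i f u v" if "u \<in> I" for i u v
    using f that by (auto simp: C1_plane_on_def)
  have "continuous_on (I \<times> UNIV) (\<lambda>(u, v). blinfun_scaleR_left (pd 2 f u v))"
    using f bounded_linear.continuous_on[OF bounded_linear_blinfun_scaleR_left, of "I \<times> UNIV" "\<lambda>(u, v). pd 2 f u v"]
    by (simp add: C1_plane_on_def case_prod_unfold)
  then have "((\<lambda>(u, v). f u v) has_derivative
      (\<lambda>(s, t). s *\<^sub>R pd 1 f u v + blinfun_scaleR_left (pd 2 f u v) t)) (at (u, v) within I \<times> UNIV)"
    using u has_pd_1D[OF pd[OF u]] has_pd_2D[OF pd]
    by (intro has_derivative_partialsI)
      (auto simp: has_vector_derivative_def continuous_on_eq_continuous_within
        intro: has_derivative_at_withinI)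
  then show "continuous (at (u, v) within I \<times> UNIV) (\<lambda>(u, v). f u v)"
    by (rule has_derivative_continuous)
qed

text \<open>Writing \<open>f(u, v)\<close> as \<open>f(u, v\<^sub>0)\<close> plus the integral of \<open>f\<^sub>2\<close> and differentiating under the integral
  sign shows that one continuous mixed partial derivative is enough for the existence of the other.\<close>

lemma mixed_partials:
  fixes f :: "real \<Rightarrow> real \<Rightarrow> real"
  assumes I: "open I" "is_interval I"
    and f1: "\<And>u v. u \<in> I \<Longrightarrow> ((\<lambda>t. f t v) has_real_derivative f1 u v) (at u)"
    and f2: "\<And>u v. u \<in> I \<Longrightarrow> ((\<lambda>t. f u t) has_real_derivative f2 u v) (at v)"
    and f12: "\<And>u v. u \<in> I \<Longrightarrow> ((\<lambda>t. f2 t v) has_real_derivative f12 u v) (at u)"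
    and f2_cont: "\<And>u. u \<in> I \<Longrightarrow> continuous_on UNIV (f2 u)"
    and f12_cont: "continuous_on (I \<times> UNIV) (\<lambda>(u, v). f12 u v)"
    and u: "u \<in> I"
  shows "((\<lambda>t. f1 u t) has_real_derivative f12 u v) (at v)"
proof -
  \<comment> \<open>The base point of the integrals lies strictly left of \<open>v\<close>, so that
    \<open>v\<close> is interior to \<open>{a..v + 1}\<close> and to \<open>{a<..}\<close>.\<close>
  define a where "a = v - 1"
  have f1_eq: "f1 u t = f1 u a + integral {a..t} (f12 u)" if t: "t \<in> {a<..}" for t
  proof -
    have at: "a \<le> t" using t by simp
    have int: "f2 r integrable_on {a..t}" if "r \<in> I" for r
      using f2_cont[OF that] by (meson continuous_on_subset integrable_continuous_real subset_UNIV)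
    have "((\<lambda>r. integral (cbox a t) (f2 r)) has_real_derivative integral (cbox a t) (f12 u)) (at u within I)"
    proof (rule leibniz_rule_field_derivative[where fx = f12])
      show "((\<lambda>r. f2 r t) has_real_derivative f12 r t) (at r within I)" if "r \<in> I" for r t
        by (rule has_field_derivative_at_within[OF f12[OF that]])
      show "continuous_on (I \<times> cbox a t) (\<lambda>(x, t). f12 x t)"
        using f12_cont by (rule continuous_on_subset) auto
      show "convex I" using I(2) by (simp add: is_interval_convex)
    qed (use u int in simp_all)
    then have "((\<lambda>r. integral {a..t} (f2 r)) has_real_derivative integral {a..t} (f12 u)) (at u)"
      by (simp add: at_within_open[OF u I(1)])
    from DERIV_add[OF f1[OF u] this]
    have *: "((\<lambda>r. f r a + integral {a..t} (f2 r)) has_real_derivative f1 u a + integral {a..t} (f12 u)) (at u)" .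
    have "f r a + integral {a..t} (f2 r) = f r t" if "r \<in> I" for r
    proof -
      have "(f2 r has_integral f r t - f r a) {a..t}"
        using at f2[OF that]
        by (intro fundamental_theorem_of_calculus)
          (auto simp: has_real_derivative_iff_has_vector_derivative intro: has_vector_derivative_at_within)
      then show ?thesis by (simp add: integral_unique)
    qed
    then have "((\<lambda>r. f r t) has_real_derivative f1 u a + integral {a..t} (f12 u)) (at u)"
      by (rule has_field_derivative_transform_within_open[OF * I(1) u])
    with f1[OF u] show ?thesis by (rule DERIV_unique)
  qed
  have cont: "continuous_on {a..v + 1} (f12 u)"
    using continuous_on_compose2[OF f12_cont continuous_on_Pair[OF continuous_on_const[where c = u] continuous_on_id[where s = "{a..v + 1}"]]] u
    by auto
  have "((\<lambda>t. integral {a..t} (f12 u)) has_vector_derivative f12 u v) (at v within {a..v + 1})"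
    by (rule integral_has_vector_derivative[OF cont]) (simp add: a_def)
  then have "((\<lambda>t. f1 u a + integral {a..t} (f12 u)) has_real_derivative f12 u v) (at v)"
    by (auto simp: has_real_derivative_iff_has_vector_derivative at_within_Icc_at a_def
        intro!: derivative_eq_intros)
  then show ?thesis
    by (rule has_field_derivative_transform_within_open[of _ _ _ "{a<..}"]) (use f1_eq in \<open>auto simp: a_def\<close>)
qed

text \<open>\<open>matrix_inv\<close> is a choice; since \<open>B\<close> witnesses a two-sided
  inverse, the chosen matrix is one as well, and associativity identifies it with
  \<open>B\<close>.\<close>

lemma matrix_inv_eqI:
  fixes A :: "'a::semiring_1^'n^'m"
  assumes "A ** B = mat 1" "B ** A = mat 1"
  shows "matrix_inv A = B"
proof -
  have "A ** matrix_inv A = mat 1 \<and> matrix_inv A ** A = mat 1"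
    unfolding matrix_inv_def by (rule someI[of _ B]) (simp add: assms)
  then have "matrix_inv A = matrix_inv A ** (A ** B)" and "matrix_inv A ** A = mat 1"
    by (simp_all add: assms)
  then show ?thesis
    by (simp add: matrix_mul_assoc)
qed

lemma matrix_inv_null_2:
  fixes A :: "real^2^2"
  assumes "A $ 1 $ 1 = E" "A $ 1 $ 2 = F" "A $ 2 $ 1 = F" "A $ 2 $ 2 = 0" "F \<noteq> 0"
  shows "matrix_inv A $ 1 $ 1 = 0" "matrix_inv A $ 1 $ 2 = 1 / F"
    "matrix_inv A $ 2 $ 1 = 1 / F" "matrix_inv A $ 2 $ 2 = - E / F\<^sup>2"
proof -
  let ?B = "vector [vector [0, 1 / F], vector [1 / F, - E / F\<^sup>2]] :: real^2^2"
  have "matrix_inv A = ?B"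
    by (rule matrix_inv_eqI)
      (use assms in \<open>simp_all add: vec_eq_iff forall_2 matrix_matrix_mult_def sum_2 mat_def
        power2_eq_square\<close>)
  then show "matrix_inv A $ 1 $ 1 = 0" "matrix_inv A $ 1 $ 2 = 1 / F"
    "matrix_inv A $ 2 $ 1 = 1 / F" "matrix_inv A $ 2 $ 2 = - E / F\<^sup>2"
    by simp_all
qed


section \<open>Metrics with a null coordinate\<close>

text \<open>The vanishing entry says that the curves u = const are null. The partial derivatives are
  parameters, so that an instance can supply explicit quotients for them.\<close>

locale null_metric =
  fixes I :: "real set" and G :: metric and E F E1 E2 F1 F2 :: "real \<Rightarrow> real \<Rightarrow> real"
  assumes open_I: "open I"
    and G: "u \<in> I \<Longrightarrow> G u v $ 1 $ 1 = E u v" "u \<in> I \<Longrightarrow> G u v $ 1 $ 2 = F u v"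
      "u \<in> I \<Longrightarrow> G u v $ 2 $ 1 = F u v" "u \<in> I \<Longrightarrow> G u v $ 2 $ 2 = 0"
    and F_nz: "u \<in> I \<Longrightarrow> F u v \<noteq> 0"
    and E1: "u \<in> I \<Longrightarrow> ((\<lambda>t. E t v) has_real_derivative E1 u v) (at u)"
    and E2: "u \<in> I \<Longrightarrow> ((\<lambda>t. E u t) has_real_derivative E2 u v) (at v)"
    and F1: "u \<in> I \<Longrightarrow> ((\<lambda>t. F t v) has_real_derivative F1 u v) (at u)"
    and F2: "u \<in> I \<Longrightarrow> ((\<lambda>t. F u t) has_real_derivative F2 u v) (at v)"
begin

lemma pd_G:
  assumes "u \<in> I"
  shows "pd 1 (\<lambda>u v. G u v $ 1 $ 1) u v = E1 u v" "pd 2 (\<lambda>u v. G u v $ 1 $ 1) u v = E2 u v"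
    "pd 1 (\<lambda>u v. G u v $ 1 $ 2) u v = F1 u v" "pd 2 (\<lambda>u v. G u v $ 1 $ 2) u v = F2 u v"
    "pd 1 (\<lambda>u v. G u v $ 2 $ 1) u v = F1 u v" "pd 2 (\<lambda>u v. G u v $ 2 $ 1) u v = F2 u v"
    "pd 1 (\<lambda>u v. G u v $ 2 $ 2) u v = 0" "pd 2 (\<lambda>u v. G u v $ 2 $ 2) u v = 0"
  by ((rule pd_1_real_eqI[OF open_I assms _ E1[OF assms]] pd_1_real_eqI[OF open_I assms _ F1[OF assms]]
      pd_1_real_eqI[OF open_I assms _ DERIV_const]
      pd_2_real_eqI[OF _ E2[OF assms]] pd_2_real_eqI[OF _ F2[OF assms]] pd_2_real_eqI[OF _ DERIV_const];
      simp add: G assms; fail)+)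

text \<open>The inverse metric has a zero in position (1, 1), so upper index 1 meets only the
  bracket with \<open>l = 2\<close>; there G_22 = 0 makes everything cancel except for i = j =
  1.\<close>

lemma christoffel:
  assumes "u \<in> I"
  shows "christoffel G 1 1 1 u v = (F1 u v - E2 u v / 2) / F u v"
    "christoffel G 1 1 2 u v = 0" "christoffel G 1 2 1 u v = 0" "christoffel G 1 2 2 u v = 0"
    "christoffel G 2 1 1 u v = E1 u v / (2 * F u v) - E u v * (F1 u v - E2 u v / 2) / (F u v)\<^sup>2"
    "christoffel G 2 1 2 u v = E2 u v / (2 * F u v)"
    "christoffel G 2 2 1 u v = E2 u v / (2 * F u v)"
    "christoffel G 2 2 2 u v = F2 u v / F u v"
  unfolding christoffel_def sum_2 pd_G[OF assms] matrix_inv_null_2[OF G[OF assms] F_nz[OF assms]]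
  using F_nz[OF assms, of v]
  by (simp_all add: field_simps power2_eq_square)

text \<open>Symbols with upper index 1 and a lower index 2 vanish. This removes the component of R
  with upper index 1 and cancels the quadratic terms of the other one, leaving \<open>F\<close>
  times the difference of the u-derivative of \<open>christoffel G 2 2 2\<close> and the
  v-derivative of \<open>christoffel G 2 1 2\<close>, over det G = -F^2.\<close>

lemma curvature:
  assumes u: "u \<in> I"
    and F12: "((\<lambda>t. F2 t v) has_real_derivative F12) (at u)"
    and E22: "((\<lambda>t. E2 u t) has_real_derivative E22) (at v)"
  shows "metric_curvature G u v =
    - ((F12 * F u v - F1 u v * F2 u v) - (E22 * F u v - E2 u v * F2 u v) / 2) / F u v ^ 3"
proof -
  have nz: "F u v \<noteq> 0" by (rule F_nz[OF u])
  have "pd 1 (christoffel G 2 2 2) u v = (F12 * F u v - F2 u v * F1 u v) / (F u v * F u v)"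
    by (rule pd_1_real_eqI[OF open_I u]) (auto simp: christoffel intro!: F12 F1 u nz DERIV_divide)
  moreover have "pd 2 (christoffel G 2 1 2) u v = (E22 * (2 * F u v) - E2 u v * (2 * F2 u v)) / ((2 * F u v) * (2 * F u v))"
    using nz by (intro pd_2_real_eqI[OF _ DERIV_divide[OF E22 DERIV_cmult[OF F2[OF u]]]])
      (simp_all add: christoffel u)
  moreover have "pd 1 (christoffel G 1 2 2) u v = 0" "pd 2 (christoffel G 1 1 2) u v = 0"
    by (rule pd_1_real_eqI[OF open_I u _ DERIV_const] pd_2_real_eqI[OF _ DERIV_const];
      simp add: christoffel u)+
  ultimately show ?thesis
    using nz unfolding metric_curvature_def riemann_def riemann_up_def det_2
    by (simp add: sum_2 G u christoffel field_simps power2_eq_square power3_eq_cube)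
qed

end

text \<open>Since \<open>G\<^sub>2\<^sub>2 = 0\<close> forces \<open>G\<^sup>1\<^sup>1 = 0\<close>, the component \<open>A 1 1 1\<close> only meets \<open>A 2 2 2\<close>.\<close>

lemma cubic_norm_null_2:
  fixes A :: "2 \<Rightarrow> 2 \<Rightarrow> 2 \<Rightarrow> real" and B :: "real^2^2"
  assumes "B $ 1 $ 1 = 0" "B $ 1 $ 2 = g" "B $ 2 $ 1 = g" "B $ 2 $ 2 = h"
    and "A 1 1 2 = a" "A 1 2 1 = a" "A 2 1 1 = a" "A 1 2 2 = b" "A 2 1 2 = b" "A 2 2 1 = b"
    and "A 2 2 2 = 0"
  shows "(\<Sum>i\<in>UNIV. \<Sum>j\<in>UNIV. \<Sum>k\<in>UNIV. A i j k *
           (\<Sum>l\<in>UNIV. \<Sum>m\<in>UNIV. \<Sum>n\<in>UNIV. B $ i $ l * B $ j $ m * B $ k $ n * A l m n))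
     = 6 * b * g\<^sup>2 * (a * g + b * h)"
  unfolding sum_2 assms by (simp add: algebra_simps power2_eq_square)


section \<open>The frame of a skew ruled surface\<close>

lemmas has_vector_derivative_inner = bounded_bilinear.has_vector_derivative[OF bounded_bilinear_inner]
lemmas has_vector_derivative_cross3 =
  bounded_bilinear.has_vector_derivative[OF bilinear_cross[unfolded bilinear_conv_bounded_bilinear]]

lemma has_real_derivative_inner:
  assumes "(f has_vector_derivative f') (at t)" "(g has_vector_derivative g') (at t)"
  shows "((\<lambda>t. f t \<bullet> g t) has_real_derivative f t \<bullet> g' + f' \<bullet> g t) (at t)"
  using has_vector_derivative_inner[OF assms]
  by (simp add: has_real_derivative_iff_has_vector_derivative)

lemmas scale_deriv = bounded_linear.has_vector_derivative[OF bounded_linear_scaleR_right]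

lemma line_deriv: "((\<lambda>t. a + t *\<^sub>R b) has_vector_derivative b) (at t)"
  by (auto intro!: derivative_eq_intros)

lemma Ck_on_SucD:
  assumes "Ck_on (Suc k) f I"
  shows "t \<in> I \<Longrightarrow> (f has_vector_derivative vector_derivative f (at t)) (at t)"
    and "Ck_on k (\<lambda>t. vector_derivative f (at t)) I"
  using assms by (simp_all add: vector_derivative_works)

text \<open>For the expansion, the part \<open>b\<close> of \<open>a\<close> orthogonal to
  \<open>e\<close> and \<open>n\<close> has zero cross product with \<open>cross3 e n\<close> by the
  Lagrange identity; a second use of that identity makes \<open>b\<close> a multiple of
  \<open>cross3 e n\<close>.\<close>

lemma orthonormal_cross3:
  fixes e n :: "real^3"
  assumes "e \<bullet> e = 1" "n \<bullet> n = 1" "e \<bullet> n = 0"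
  shows "cross3 e n \<bullet> cross3 e n = 1" "cross3 n (cross3 e n) = e" "cross3 (cross3 e n) e = n"
    and "a = (a \<bullet> e) *\<^sub>R e + (a \<bullet> n) *\<^sub>R n + (a \<bullet> cross3 e n) *\<^sub>R cross3 e n"
proof -
  show zz: "cross3 e n \<bullet> cross3 e n = 1"
    using norm_cross_dot[of e n] assms by (simp add: power2_norm_eq_inner power_mult_distrib)
  show nz: "cross3 n (cross3 e n) = e"
    using assms by (simp add: Lagrange inner_commute[of n e])
  show ze: "cross3 (cross3 e n) e = n"
    using assms by (subst cross_skew) (simp add: Lagrange inner_commute)
  define b where "b = a - (a \<bullet> e) *\<^sub>R e - (a \<bullet> n) *\<^sub>R n"
  have "b \<bullet> e = 0" "b \<bullet> n = 0"
    using assms inner_commute[of n e] by (simp_all add: b_def inner_diff_left)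
  then have "cross3 b (cross3 e n) = 0"
    by (simp add: Lagrange)
  then have "b = (cross3 e n \<bullet> b) *\<^sub>R cross3 e n"
    using Lagrange[of "cross3 e n" b "cross3 e n"] by (simp add: zz)
  moreover have "cross3 e n \<bullet> b = a \<bullet> cross3 e n"
    by (simp add: b_def inner_diff_right dot_cross_self inner_commute)
  ultimately show "a = (a \<bullet> e) *\<^sub>R e + (a \<bullet> n) *\<^sub>R n + (a \<bullet> cross3 e n) *\<^sub>R cross3 e n"
    by (simp add: b_def algebra_simps)
qed

section \<open>Frame equations and invariants of the ruled surface\<close>

locale normalized_skew_ruled_surface =
  fixes I :: "real set" and s e :: "real \<Rightarrow> real^3" and y :: surface
    and \<Lambda> :: "real \<Rightarrow> real"
  assumes ruled: "skew_ruled_surface I s e"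
    and lambda: "is_ruled_lambda I s e \<Lambda>"
    and normalization: "relative_normalization (I \<times> UNIV) (ruled_surface s e) y"
begin

abbreviation x where "x \<equiv> ruled_surface s e"

definition "s1 = (\<lambda>u. curve_deriv s u)"
definition "s2 = (\<lambda>u. curve_deriv s1 u)"
definition "s3 = (\<lambda>u. curve_deriv s2 u)"
definition "n = (\<lambda>u. curve_deriv e u)"
definition "n1 = (\<lambda>u. curve_deriv n u)"
definition "n2 = (\<lambda>u. curve_deriv n1 u)"
definition "z = (\<lambda>u. cross3 (e u) (n u))"

text \<open>\<open>d\<close>, \<open>k\<close>, \<open>m\<close> are \<open>\<delta>\<close>, \<open>\<kappa>\<close>, \<open>\<delta> \<lambda>\<close>. Unlike \<open>\<lambda>\<close>, \<open>m\<close> is differentiable by its definition.\<close>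

definition "d = (\<lambda>u. s1 u \<bullet> z u)"
definition "k = (\<lambda>u. n1 u \<bullet> z u)"
definition "m = (\<lambda>u. s1 u \<bullet> e u)"
definition "d1 = (\<lambda>u. s2 u \<bullet> z u)"

lemma open_I: "open I" and interval_I: "is_interval I"
  using ruled by (auto simp: skew_ruled_surface_def)

lemma Ck: "Ck_on (Suc (Suc (Suc (Suc 0)))) s I" "Ck_on (Suc (Suc (Suc (Suc 0)))) e I"
  using ruled by (simp_all add: skew_ruled_surface_def eval_nat_numeral)

lemma curve_derivs:
  assumes "u \<in> I"
  shows "(s has_vector_derivative s1 u) (at u)" "(s1 has_vector_derivative s2 u) (at u)"
    "(s2 has_vector_derivative s3 u) (at u)" "(e has_vector_derivative n u) (at u)"
    "(n has_vector_derivative n1 u) (at u)" "(n1 has_vector_derivative n2 u) (at u)"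
proof -
  note s = Ck(1)
  note s1 = Ck_on_SucD(2)[OF s, folded s1_def]
  note s2 = Ck_on_SucD(2)[OF s1, folded s2_def]
  note e = Ck(2)
  note n = Ck_on_SucD(2)[OF e, folded n_def]
  note n1 = Ck_on_SucD(2)[OF n, folded n1_def]
  show "(s has_vector_derivative s1 u) (at u)" "(s1 has_vector_derivative s2 u) (at u)"
    "(s2 has_vector_derivative s3 u) (at u)" "(e has_vector_derivative n u) (at u)"
    "(n has_vector_derivative n1 u) (at u)" "(n1 has_vector_derivative n2 u) (at u)"
    using Ck_on_SucD(1)[OF s assms] Ck_on_SucD(1)[OF s1 assms] Ck_on_SucD(1)[OF s2 assms]
      Ck_on_SucD(1)[OF e assms] Ck_on_SucD(1)[OF n assms] Ck_on_SucD(1)[OF n1 assms]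
    by (simp_all add: s1_def s2_def s3_def n_def n1_def n2_def)
qed

lemma inner_const_imp:
  assumes "u \<in> I" "\<And>t. t \<in> I \<Longrightarrow> f t \<bullet> g t = c"
    and "(f has_vector_derivative f') (at u)" "(g has_vector_derivative g') (at u)"
  shows "f' \<bullet> g u = - (f u \<bullet> g')"
proof -
  have "((\<lambda>t. f t \<bullet> g t) has_real_derivative 0) (at u)"
    by (rule has_field_derivative_transform_within_open[OF DERIV_const[of c] open_I assms(1)])
      (simp add: assms(2))
  from DERIV_unique[OF this has_real_derivative_inner[OF assms(3,4)]] show ?thesis
    by simp
qed

lemma frame:
  assumes "u \<in> I"
  shows "e u \<bullet> e u = 1" "n u \<bullet> n u = 1" "e u \<bullet> n u = 0" "n u \<bullet> e u = 0"
    "z u \<bullet> z u = 1" "e u \<bullet> z u = 0" "z u \<bullet> e u = 0" "n u \<bullet> z u = 0" "z u \<bullet> n u = 0"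
    "cross3 (e u) (n u) = z u" "cross3 (n u) (z u) = e u" "cross3 (z u) (e u) = n u"
proof -
  have ee: "e u \<bullet> e u = 1" and nn: "n u \<bullet> n u = 1" if "u \<in> I" for u
    using ruled that by (simp_all add: skew_ruled_surface_def n_def norm_eq_1)
  show "e u \<bullet> e u = 1" "n u \<bullet> n u = 1"
    by (simp_all add: ee nn assms)
  show en: "e u \<bullet> n u = 0"
    using inner_const_imp[OF assms ee curve_derivs(4)[OF assms] curve_derivs(4)[OF assms]]
      inner_commute[of "n u" "e u"] by linarith
  then show "n u \<bullet> e u = 0" by (simp add: inner_commute)
  show "cross3 (e u) (n u) = z u" by (simp add: z_def)
  show "z u \<bullet> z u = 1" "cross3 (n u) (z u) = e u" "cross3 (z u) (e u) = n u"
    using orthonormal_cross3(1-3)[OF ee[OF assms] nn[OF assms] en] by (simp_all add: z_def)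
  show "e u \<bullet> z u = 0" "z u \<bullet> e u = 0" "n u \<bullet> z u = 0" "z u \<bullet> n u = 0"
    by (simp_all add: z_def dot_cross_self)
qed

lemma frame_expansion:
  assumes "u \<in> I"
  shows "a = (a \<bullet> e u) *\<^sub>R e u + (a \<bullet> n u) *\<^sub>R n u + (a \<bullet> z u) *\<^sub>R z u"
  unfolding z_def by (rule orthonormal_cross3(4)[OF frame(1-3)[OF assms]])

text \<open>The coefficients come from differentiating n.e = 0, where e' = n is a unit vector, and
  n.n = 1; the remaining one is \<open>k\<close> by definition.\<close>

lemma n1_eq: "u \<in> I \<Longrightarrow> n1 u = - e u + k u *\<^sub>R z u"
proof -
  assume u: "u \<in> I"
  have e: "n1 u \<bullet> e u = -1"
    using inner_const_imp[OF u frame(4) curve_derivs(5)[OF u] curve_derivs(4)[OF u]]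
    by (simp add: frame[OF u])
  have n: "n1 u \<bullet> n u = 0"
    using inner_const_imp[OF u frame(2) curve_derivs(5)[OF u] curve_derivs(5)[OF u]]
      inner_commute[of "n u" "n1 u"] by linarith
  have "n1 u = (n1 u \<bullet> e u) *\<^sub>R e u + (n1 u \<bullet> n u) *\<^sub>R n u + (n1 u \<bullet> z u) *\<^sub>R z u"
    by (rule frame_expansion[OF u])
  also have "\<dots> = - e u + k u *\<^sub>R z u"
    by (simp add: e n k_def)
  finally show "n1 u = - e u + k u *\<^sub>R z u" .
qed

lemma z_deriv: "u \<in> I \<Longrightarrow> (z has_vector_derivative - k u *\<^sub>R n u) (at u)"
proof -
  assume u: "u \<in> I"
  have "cross3 (e u) (n1 u) + cross3 (n u) (n u) = - k u *\<^sub>R n u"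
    using cross_skew[of "e u" "z u"] frame[OF u]
    by (simp add: n1_eq[OF u] cross_add_right cross_mult_right Cross3.right_diff_distrib)
  then show ?thesis
    using has_vector_derivative_cross3[OF curve_derivs(4,5)[OF u]] by (simp add: z_def)
qed

lemma s1_eq: "u \<in> I \<Longrightarrow> s1 u = m u *\<^sub>R e u + d u *\<^sub>R z u" and s1_n: "u \<in> I \<Longrightarrow> s1 u \<bullet> n u = 0"
proof -
  assume u: "u \<in> I"
  show *: "s1 u \<bullet> n u = 0"
    using ruled u by (simp add: skew_ruled_surface_def s1_def n_def)
  have "s1 u = (s1 u \<bullet> e u) *\<^sub>R e u + (s1 u \<bullet> n u) *\<^sub>R n u + (s1 u \<bullet> z u) *\<^sub>R z u"
    by (rule frame_expansion[OF u])
  also have "\<dots> = m u *\<^sub>R e u + d u *\<^sub>R z u"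
    by (simp add: * m_def d_def)
  finally show "s1 u = m u *\<^sub>R e u + d u *\<^sub>R z u" .
qed

text \<open>Differentiating s'.n = 0 moves the derivative onto n, where the frame equation for n'
  applies.\<close>

lemma s2_n: "u \<in> I \<Longrightarrow> s2 u \<bullet> n u = m u - k u * d u"
  using inner_const_imp[OF _ s1_n curve_derivs(2,5)]
  by (simp add: n1_eq inner_diff_right inner_add_right m_def d_def)

text \<open>The term s'.z' drops out: z' is a multiple of n, and s' is orthogonal to n. Thus
  \<open>d1\<close> is \<delta>'.\<close>

lemma d_deriv: "u \<in> I \<Longrightarrow> (d has_real_derivative d1 u) (at u)"
  using has_real_derivative_inner[OF curve_derivs(2) z_deriv, of u]
  by (simp add: d_def d1_def s1_n)

lemma ruled_delta_eq: "ruled_delta s e = d"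
  by (simp add: fun_eq_iff ruled_delta_def triple_product_def d_def z_def s1_def n_def)

lemma ruled_kappa_eq: "ruled_kappa e = k"
proof
  fix u
  have "triple_product (e u) (n u) (n1 u) = n1 u \<bullet> cross3 (e u) (n u)"
    using cross_triple[of "e u" "n u" "n1 u"] by (simp add: triple_product_def inner_commute)
  then show "ruled_kappa e u = k u"
    by (simp add: ruled_kappa_def k_def z_def n_def n1_def)
qed

lemma m_eq: "u \<in> I \<Longrightarrow> m u = d u * \<Lambda> u"
  using lambda frame[of u] unfolding is_ruled_lambda_def ruled_delta_eq
  by (simp add: m_def s1_def n_def z_def inner_add_left dot_cross_self)

text \<open>Only existence matters, as none of these three derivatives enters the final formulas.
  That of \<open>d1\<close> uses s''' and that of \<open>k\<close> uses e'''.\<close>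

lemma invariant_derivs:
  assumes u: "u \<in> I"
  shows "(k has_real_derivative deriv k u) (at u)" "(d1 has_real_derivative deriv d1 u) (at u)"
    "(m has_real_derivative deriv m u) (at u)"
proof -
  have "(k has_real_derivative n1 u \<bullet> (- k u *\<^sub>R n u) + n2 u \<bullet> z u) (at u)"
    using has_real_derivative_inner[OF curve_derivs(6)[OF u] z_deriv[OF u]]
    by (simp add: k_def[abs_def])
  then show "(k has_real_derivative deriv k u) (at u)"
    by (metis DERIV_imp_deriv)
  have "(d1 has_real_derivative s2 u \<bullet> (- k u *\<^sub>R n u) + s3 u \<bullet> z u) (at u)"
    unfolding d1_def by (rule has_real_derivative_inner[OF curve_derivs(3)[OF u] z_deriv[OF u]])
  then show "(d1 has_real_derivative deriv d1 u) (at u)"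
    by (metis DERIV_imp_deriv)
  have "(m has_real_derivative s1 u \<bullet> n u + s2 u \<bullet> e u) (at u)"
    unfolding m_def by (rule has_real_derivative_inner[OF curve_derivs(2)[OF u] curve_derivs(4)[OF u]])
  then show "(m has_real_derivative deriv m u) (at u)"
    by (metis DERIV_imp_deriv)
qed

section \<open>Coordinate vectors, normal and second fundamental form\<close>

definition "x1 = (\<lambda>u v. m u *\<^sub>R e u + v *\<^sub>R n u + d u *\<^sub>R z u)"
text \<open>Not expanded in the frame: only its product with \<open>N\<close> and its v-derivative
  \<open>n1\<close> are used.\<close>

definition "x11 = (\<lambda>u v. s2 u + v *\<^sub>R n1 u)"

definition "N = (\<lambda>u v. d u *\<^sub>R n u - v *\<^sub>R z u)"

lemma x1_deriv:
  assumes "u \<in> I"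
  shows "((\<lambda>t. x1 t v) has_vector_derivative x11 u v) (at u)"
    "((\<lambda>t. x1 u t) has_vector_derivative n u) (at v)"
proof -
  have "((\<lambda>t. s1 t + v *\<^sub>R n t) has_vector_derivative x11 u v) (at u)"
    unfolding x11_def by (intro has_vector_derivative_add scale_deriv curve_derivs assms)
  then show "((\<lambda>t. x1 t v) has_vector_derivative x11 u v) (at u)"
    by (rule has_vector_derivative_transform_within_open[OF _ open_I assms])
      (simp add: x1_def s1_eq)
  show "((\<lambda>t. x1 u t) has_vector_derivative n u) (at v)"
    using line_deriv[of "m u *\<^sub>R e u + d u *\<^sub>R z u" "n u" v] by (simp add: x1_def algebra_simps)
qed

lemma pd_x:
  assumes "u \<in> I"
  shows "pd 1 x u v = x1 u v" "pd 2 x u v = e u"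
proof -
  have "pd 1 x u v = s1 u + v *\<^sub>R n u"
    by (rule pd_1_eqI[OF open_I assms _ has_vector_derivative_add[OF curve_derivs(1)[OF assms]
          scale_deriv[OF curve_derivs(4)[OF assms]]]])
      (simp add: ruled_surface_def)
  then show "pd 1 x u v = x1 u v"
    by (simp add: x1_def s1_eq[OF assms])
  show "pd 2 x u v = e u"
    by (rule pd_2_eqI[OF _ line_deriv]) (simp add: ruled_surface_def)
qed

lemma pd_pd_x:
  assumes "u \<in> I"
  shows "pd 1 (pd 1 x) u v = x11 u v" "pd 1 (pd 2 x) u v = n u"
    "pd 2 (pd 1 x) u v = n u" "pd 2 (pd 2 x) u v = 0"
proof -
  show "pd 1 (pd 1 x) u v = x11 u v" "pd 1 (pd 2 x) u v = n u"
    by (rule pd_1_eqI[OF open_I assms _ x1_deriv(1)] pd_1_eqI[OF open_I assms _ curve_derivs(4)];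
        simp add: pd_x assms)+
  show "pd 2 (pd 1 x) u v = n u" "pd 2 (pd 2 x) u v = 0"
    by (rule pd_2_eqI[OF _ x1_deriv(2)] pd_2_eqI[OF _ has_vector_derivative_const];
        simp add: pd_x assms)+
qed

lemma cross_x1_e: "u \<in> I \<Longrightarrow> cross3 (x1 u v) (e u) = N u v"
  using cross_skew[of "n u" "e u"]
  by (simp add: x1_def N_def cross_add_left cross_mult_left frame)

text \<open>If \<delta> vanished, the parametrization would be singular at v = 0. There the normal
  is \<open>sgn 0 = 0\<close>, so the second fundamental form and the Gaussian curvature would be
  0.\<close>

lemma d_nz: "u \<in> I \<Longrightarrow> d u \<noteq> 0"
proof
  assume u: "u \<in> I" and "d u = 0"
  then have "pd 1 x u 0 = 0"
    using m_eq[OF u] by (simp add: pd_x x1_def)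
  then have "gaussian_curvature x u 0 = 0"
    by (simp add: gaussian_curvature_def second_ff_def unit_normal_def det_2)
  then show False
    using ruled u by (simp add: skew_ruled_surface_def)
qed

definition "w = (\<lambda>u v. sqrt ((d u)\<^sup>2 + v\<^sup>2))"

lemma w_pos: "u \<in> I \<Longrightarrow> w u v > 0"
  using d_nz by (simp add: w_def sum_power2_gt_zero_iff)

lemma w_power2: "(w u v)\<^sup>2 = (d u)\<^sup>2 + v\<^sup>2"
  by (simp add: w_def)

lemma unit_normal_eq: "u \<in> I \<Longrightarrow> unit_normal x u v = N u v /\<^sub>R w u v"
proof -
  assume u: "u \<in> I"
  have "norm (N u v) = w u v"
    unfolding norm_eq_sqrt_inner w_def using frame[OF u]
    by (simp add: N_def inner_diff_left inner_diff_right power2_eq_square)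
  then show ?thesis
    by (simp add: unit_normal_def pd_x u cross_x1_e sgn_div_norm)
qed

text \<open>The coefficient \<open>h\<^sub>1\<^sub>1\<close> of the second fundamental form, multiplied by \<open>w\<close>.\<close>

definition "h11 = (\<lambda>u v. d u * m u - k u * ((d u)\<^sup>2 + v\<^sup>2) - d1 u * v)"

lemma N_inner:
  assumes "u \<in> I"
  shows "N u v \<bullet> x1 u v = 0" "N u v \<bullet> e u = 0" "N u v \<bullet> n u = d u"
    "N u v \<bullet> n1 u = - k u * v" "N u v \<bullet> x11 u v = h11 u v"
proof -
  note simps = N_def inner_diff_left inner_diff_right inner_add_left inner_add_right frame[OF assms]
  show "N u v \<bullet> x1 u v = 0" "N u v \<bullet> e u = 0" "N u v \<bullet> n u = d u"
    by (simp_all add: simps x1_def)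
  show n1: "N u v \<bullet> n1 u = - k u * v"
    by (simp add: n1_eq[OF assms] simps)
  have "N u v \<bullet> s2 u = d u * (m u - k u * d u) - v * d1 u"
    by (simp add: N_def inner_diff_left d1_def s2_n[OF assms, symmetric]
        inner_commute[of "n u" "s2 u"] inner_commute[of "z u" "s2 u"])
  then show "N u v \<bullet> x11 u v = h11 u v"
    by (simp add: x11_def inner_add_right n1 h11_def power2_eq_square algebra_simps)
qed

lemma second_ff:
  assumes "u \<in> I"
  shows "second_ff x u v $ 1 $ 1 = h11 u v / w u v" "second_ff x u v $ 1 $ 2 = d u / w u v"
    "second_ff x u v $ 2 $ 1 = d u / w u v" "second_ff x u v $ 2 $ 2 = 0"
  by (simp_all add: second_ff_def unit_normal_eq pd_pd_x assms N_inner divide_inverse)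

section \<open>The relative normalization and the function \<open>p\<close>\<close>

definition "p = (\<lambda>u v. N u v \<bullet> y u v)"

lemma support: "u \<in> I \<Longrightarrow> support_function x y u v = p u v / w u v"
  by (simp add: support_function_def unit_normal_eq p_def divide_inverse)

text \<open>Otherwise \<open>y\<close> would be tangent, against linear independence. The
  z-component forces the coefficient \<open>c / d u\<close> of \<open>x1\<close>; the equation
  \<open>d u * b = v * c\<close>, which is p = 0, makes the n-components agree, and \<open>e\<close>
  absorbs the rest.\<close>

lemma p_nz: "u \<in> I \<Longrightarrow> p u v \<noteq> 0"
proof
  assume u: "u \<in> I" and "p u v = 0"
  define a b c where "a = y u v \<bullet> e u" "b = y u v \<bullet> n u" "c = y u v \<bullet> z u"
  have "d u * b = v * c"
    using \<open>p u v = 0\<close> by (simp add: p_def N_def a_b_c_def inner_diff_left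
        inner_commute[of "n u" "y u v"] inner_commute[of "z u" "y u v"])
  then have x1: "(c / d u) *\<^sub>R x1 u v = (c * m u / d u) *\<^sub>R e u + b *\<^sub>R n u + c *\<^sub>R z u"
    using d_nz[OF u] by (simp add: x1_def scaleR_add_right field_simps)
  have y: "y u v = a *\<^sub>R e u + b *\<^sub>R n u + c *\<^sub>R z u"
    unfolding a_b_c_def by (rule frame_expansion[OF u])
  have "(c / d u) *\<^sub>R x1 u v + (a - c * m u / d u) *\<^sub>R e u + (-1) *\<^sub>R y u v = 0"
    unfolding x1 y by (simp add: scaleR_diff_left)
  moreover have "\<forall>a b c. a *\<^sub>R x1 u v + b *\<^sub>R e u + c *\<^sub>R y u v = 0 \<longrightarrow> a = 0 \<and> b = 0 \<and> c = 0"
    using normalization[unfolded relative_normalization_def, THEN conjunct2, THEN bspec, of "(u, v)"] u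
    unfolding pd_x(1)[OF u, symmetric] pd_x(2)[OF u, of v, symmetric] by blast
  ultimately have "(-1 :: real) = 0"
    by blast
  then show False
    by simp
qed

lemma relative_metric:
  assumes "u \<in> I"
  shows "relative_metric x y u v $ 1 $ 1 = h11 u v / p u v"
    "relative_metric x y u v $ 1 $ 2 = d u / p u v"
    "relative_metric x y u v $ 2 $ 1 = d u / p u v" "relative_metric x y u v $ 2 $ 2 = 0"
  using w_pos[OF assms, of v] by (simp_all add: relative_metric_def second_ff support assms)

definition "y1 = pd 1 y"
definition "y2 = pd 2 y"

lemma y_derivs:
  assumes "u \<in> I"
  shows "((\<lambda>t. y t v) has_vector_derivative y1 u v) (at u)"
    "((\<lambda>t. y u t) has_vector_derivative y2 u v) (at v)"
  using normalization assms unfolding relative_normalization_def C1_plane_on_def y1_def y2_def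
  by (auto intro!: has_pd_1D has_pd_2D)

text \<open>Existence of the coefficients of the shape operator; \<open>shape_operator\<close> adds
  uniqueness.\<close>

lemma y_tangent:
  assumes "u \<in> I"
  obtains B :: "real^2^2" where "y1 u v = - (B $ 1 $ 1 *\<^sub>R x1 u v + B $ 1 $ 2 *\<^sub>R e u)"
    "y2 u v = - (B $ 2 $ 1 *\<^sub>R x1 u v + B $ 2 $ 2 *\<^sub>R e u)"
proof -
  have *: "pd i y u v \<in> span {x1 u v, e u}" for i
    using normalization assms by (auto simp: relative_normalization_def pd_x)
  have "\<exists>a b. pd i y u v = - (a *\<^sub>R x1 u v + b *\<^sub>R e u)" for i
  proof -
    obtain a b where "pd i y u v - a *\<^sub>R x1 u v = b *\<^sub>R e u"
      using *[of i] by (auto simp: span_breakdown_eq span_singleton)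
    then have "pd i y u v = - ((-a) *\<^sub>R x1 u v + (-b) *\<^sub>R e u)"
      by (simp add: algebra_simps)
    then show ?thesis by blast
  qed
  then obtain a b where "\<And>i. pd i y u v = - (a i *\<^sub>R x1 u v + b i *\<^sub>R e u)"
    by metis
  then show ?thesis
    by (intro that[of "\<chi> i j. if j = 1 then a i else b i"]) (simp_all add: y1_def y2_def)
qed

lemma N_y:
  assumes "u \<in> I"
  shows "N u v \<bullet> y1 u v = 0" "N u v \<bullet> y2 u v = 0"
proof -
  obtain B :: "real^2^2" where B: "y1 u v = - (B $ 1 $ 1 *\<^sub>R x1 u v + B $ 1 $ 2 *\<^sub>R e u)"
      "y2 u v = - (B $ 2 $ 1 *\<^sub>R x1 u v + B $ 2 $ 2 *\<^sub>R e u)"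
    by (rule y_tangent[OF assms])
  show "N u v \<bullet> y1 u v = 0" "N u v \<bullet> y2 u v = 0"
    unfolding B by (simp_all add: inner_diff_right N_inner[OF assms])
qed

text \<open>The vectors paired with \<open>y\<close> in \<open>p1\<close> and \<open>p2\<close> are
  the partial derivatives of \<open>N\<close>, the second being -z. \<open>p12\<close> and
  \<open>p22\<close> are obtained from \<open>p2\<close> by the product rule, with z' = -\<kappa>
  n.\<close>

definition "p1 = (\<lambda>u v. ((d1 u + k u * v) *\<^sub>R n u + (k u * d u) *\<^sub>R z u - d u *\<^sub>R e u) \<bullet> y u v)"
definition "p2 = (\<lambda>u v. - (z u \<bullet> y u v))"
definition "p12 = (\<lambda>u v. k u * (n u \<bullet> y u v) - z u \<bullet> y1 u v)"
definition "p22 = (\<lambda>u v. - (z u \<bullet> y2 u v))"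

lemma p_derivs:
  assumes "u \<in> I"
  shows "((\<lambda>t. p t v) has_real_derivative p1 u v) (at u)"
    "((\<lambda>t. p u t) has_real_derivative p2 u v) (at v)"
    "((\<lambda>t. p2 t v) has_real_derivative p12 u v) (at u)"
    "((\<lambda>t. p2 u t) has_real_derivative p22 u v) (at v)"
proof -
  have "((\<lambda>t. N t v) has_vector_derivative
      d u *\<^sub>R n1 u + d1 u *\<^sub>R n u - (v *\<^sub>R (- k u *\<^sub>R n u) + 0 *\<^sub>R z u)) (at u)"
    unfolding N_def using assms
    by (intro has_vector_derivative_diff has_vector_derivative_scaleR
        d_deriv curve_derivs z_deriv DERIV_const)
  then have "((\<lambda>t. N t v) has_vector_derivative
      (d1 u + k u * v) *\<^sub>R n u + (k u * d u) *\<^sub>R z u - d u *\<^sub>R e u) (at u)"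
    by (simp add: n1_eq[OF assms] algebra_simps)
  from has_real_derivative_inner[OF this y_derivs(1)[OF assms, of v]]
  show "((\<lambda>t. p t v) has_real_derivative p1 u v) (at u)"
    by (simp add: p_def p1_def N_y assms)
  have "((\<lambda>t. N u t) has_vector_derivative - z u) (at v)"
    using line_deriv[of "d u *\<^sub>R n u" "- z u" v] by (simp add: N_def)
  from has_real_derivative_inner[OF this y_derivs(2)[OF assms]]
  show "((\<lambda>t. p u t) has_real_derivative p2 u v) (at v)"
    by (simp add: p_def p2_def N_y assms)
  show "((\<lambda>t. p2 t v) has_real_derivative p12 u v) (at u)"
    unfolding p2_def p12_def
    by (auto intro!: derivative_eq_intros has_real_derivative_inner z_deriv y_derivs assms)
  show "((\<lambda>t. p2 u t) has_real_derivative p22 u v) (at v)"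
    unfolding p2_def p22_def
    by (auto intro!: derivative_eq_intros has_real_derivative_inner y_derivs assms)
qed

lemma y_continuous: "continuous_on (I \<times> UNIV) (\<lambda>(u, v). y u v)"
  and y1_continuous: "continuous_on (I \<times> UNIV) (\<lambda>(u, v). y1 u v)"
  using normalization C1_plane_on_imp_continuous_on[OF _ open_I, of y]
  by (auto simp: relative_normalization_def C1_plane_on_def y1_def)

text \<open>The product rule alone expresses this derivative through \<open>y2\<close>; that it
  equals \<open>p12\<close> is the equality of mixed partial derivatives. The joint continuity of
  \<open>p12\<close> comes from that of \<open>y\<close>, \<open>y1\<close>, \<open>k\<close>,
  \<open>n\<close> and \<open>z\<close>.\<close>

lemma p1_deriv_v:
  assumes "u \<in> I"
  shows "((\<lambda>t. p1 u t) has_real_derivative p12 u v) (at v)"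
proof (rule mixed_partials[OF open_I interval_I p_derivs(1,2,3) _ _ assms])
  show "continuous_on UNIV (p2 u)" if "u \<in> I" for u
    using p_derivs(4)[OF that] by (meson DERIV_isCont continuous_at_imp_continuous_on)
  have *: "continuous_on (I \<times> UNIV) (\<lambda>a. f (fst a))"
    if "\<And>u. u \<in> I \<Longrightarrow> continuous (at u) f" for f :: "real \<Rightarrow> 'a::real_normed_vector"
    using that
    by (intro continuous_on_compose2[of I f _ fst] continuous_intros)
      (auto intro: continuous_at_imp_continuous_on)
  have "continuous_on (I \<times> UNIV) (\<lambda>a. k (fst a))" "continuous_on (I \<times> UNIV) (\<lambda>a. n (fst a))"
    "continuous_on (I \<times> UNIV) (\<lambda>a. z (fst a))"
    by (rule *, metis invariant_derivs(1) DERIV_isCont,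
        rule *, metis curve_derivs(5) has_vector_derivative_continuous,
        rule *, metis z_deriv has_vector_derivative_continuous)
  then show "continuous_on (I \<times> UNIV) (\<lambda>(u, v). p12 u v)"
    using y_continuous y1_continuous unfolding p12_def case_prod_unfold
    by (intro continuous_on_diff continuous_on_mult continuous_on_inner)
qed

section \<open>The shape operator and the mean curvature\<close>

lemma shape_operator:
  assumes u: "u \<in> I"
  obtains B where "relative_shape_operator x y u v = B"
    "y1 u v = - (B $ 1 $ 1 *\<^sub>R x1 u v + B $ 1 $ 2 *\<^sub>R e u)"
    "y2 u v = - (B $ 2 $ 1 *\<^sub>R x1 u v + B $ 2 $ 2 *\<^sub>R e u)"
proof -
  obtain B :: "real^2^2" where B: "y1 u v = - (B $ 1 $ 1 *\<^sub>R x1 u v + B $ 1 $ 2 *\<^sub>R e u)"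
    "y2 u v = - (B $ 2 $ 1 *\<^sub>R x1 u v + B $ 2 $ 2 *\<^sub>R e u)"
    by (rule y_tangent[OF u])
  have "relative_shape_operator x y u v = B"
    unfolding relative_shape_operator_def
  proof (rule the_equality)
    show "\<forall>i. pd i y u v = - (\<Sum>j\<in>UNIV. B $ i $ j *\<^sub>R pd j x u v)"
      using B by (simp add: forall_2 sum_2 pd_x[OF u] y1_def y2_def)
    fix C :: "real^2^2"
    assume C: "\<forall>i. pd i y u v = - (\<Sum>j\<in>UNIV. C $ i $ j *\<^sub>R pd j x u v)"
    have unique: "a = a' \<and> b = b'"
      if "- (a *\<^sub>R x1 u v + b *\<^sub>R e u) = - (a' *\<^sub>R x1 u v + b' *\<^sub>R e u)" for a b a' b'
    proof -
      have "(a *\<^sub>R x1 u v + b *\<^sub>R e u) \<bullet> c = (a' *\<^sub>R x1 u v + b' *\<^sub>R e u) \<bullet> c" for c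
        using that by (simp only: neg_equal_iff_equal)
      \<comment> \<open>The z-components are \<open>d u * a\<close> and \<open>d u * a'\<close>,
        which fixes \<open>a\<close>; the e-components then fix \<open>b\<close>.\<close>
      from this[of "z u"] this[of "e u"] show ?thesis
        using d_nz[OF u] by (simp add: x1_def inner_add_left frame[OF u])
    qed
    have "- (C $ 1 $ 1 *\<^sub>R x1 u v + C $ 1 $ 2 *\<^sub>R e u) = - (B $ 1 $ 1 *\<^sub>R x1 u v + B $ 1 $ 2 *\<^sub>R e u)"
      "- (C $ 2 $ 1 *\<^sub>R x1 u v + C $ 2 $ 2 *\<^sub>R e u) = - (B $ 2 $ 1 *\<^sub>R x1 u v + B $ 2 $ 2 *\<^sub>R e u)"
      using C[THEN spec, of 1] C[THEN spec, of 2]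
      unfolding B[symmetric] y1_def y2_def sum_2 pd_x[OF u] by simp_all
    from this[THEN unique] show "C = B"
      by (simp add: vec_eq_iff forall_2)
  qed
  then show ?thesis using B by (rule that)
qed

text \<open>\<open>p12\<close> and \<open>p22\<close> determine the entries (1, 1) and (2, 1) of
  \<open>B\<close>. The entry (2, 2) appears when \<open>p12\<close> is computed a second time, as
  the v-derivative of \<open>p1\<close>.\<close>

lemma mean_curvature:
  assumes u: "u \<in> I"
  shows "relative_mean_curvature x y u v =
    p12 u v / d u - k u * (p u v - v * p2 u v) / (d u)\<^sup>2 - h11 u v * p22 u v / (2 * (d u)\<^sup>2)"
proof -
  obtain B where B: "relative_shape_operator x y u v = B"
    "y1 u v = - (B $ 1 $ 1 *\<^sub>R x1 u v + B $ 1 $ 2 *\<^sub>R e u)"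
    "y2 u v = - (B $ 2 $ 1 *\<^sub>R x1 u v + B $ 2 $ 2 *\<^sub>R e u)"
    by (rule shape_operator[OF u])
  note d = d_nz[OF u]
  have frame_x1: "e u \<bullet> x1 u v = m u" "n u \<bullet> x1 u v = v" "z u \<bullet> x1 u v = d u"
    by (simp_all add: x1_def inner_add_right frame[OF u])
  have p12: "p12 u v = k u * (n u \<bullet> y u v) + B $ 1 $ 1 * d u"
    by (simp add: p12_def B(2) inner_diff_right frame_x1 frame[OF u])
  have p22: "p22 u v = B $ 2 $ 1 * d u"
    by (simp add: p22_def B(3) inner_diff_right frame_x1 frame[OF u])
  have p: "p u v = d u * (n u \<bullet> y u v) + v * p2 u v"
    by (simp add: p_def N_def p2_def inner_diff_left)
  have "((\<lambda>v. (d1 u + k u * v) *\<^sub>R n u + (k u * d u) *\<^sub>R z u - d u *\<^sub>R e u) has_vector_derivative k u *\<^sub>R n u) (at v)"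
    using line_deriv[of "d1 u *\<^sub>R n u + (k u * d u) *\<^sub>R z u - d u *\<^sub>R e u" "k u *\<^sub>R n u" v]
    by (simp add: algebra_simps)
  from has_real_derivative_inner[OF this y_derivs(2)[OF u]]
  have "p12 u v = ((d1 u + k u * v) *\<^sub>R n u + (k u * d u) *\<^sub>R z u - d u *\<^sub>R e u) \<bullet> y2 u v
      + k u * (n u \<bullet> y u v)"
    using DERIV_unique[OF p1_deriv_v[OF u]] by (simp add: p1_def)
  also have "\<dots> = k u * (n u \<bullet> y u v) - (d1 u + k u * v) * v * B $ 2 $ 1 - k u * d u * d u * B $ 2 $ 1
      + d u * (m u * B $ 2 $ 1 + B $ 2 $ 2)"
    by (simp add: B(3) inner_diff_right inner_diff_left inner_add_left frame_x1 frame[OF u] algebra_simps)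
  \<comment> \<open>This is the symmetry of the shape operator with respect to the second
    fundamental form, in which h_22 = 0.\<close>
  finally have "d u * B $ 2 $ 2 = d u * B $ 1 $ 1 - h11 u v * B $ 2 $ 1"
    unfolding p12 h11_def power2_eq_square by (simp add: algebra_simps)
  then have "B $ 2 $ 2 = B $ 1 $ 1 - h11 u v * B $ 2 $ 1 / d u"
    using d by (simp add: field_simps)
  then show ?thesis
    unfolding relative_mean_curvature_def B(1) p12 p22 p using d
    by (simp add: field_simps power2_eq_square)
qed


subsection \<open>The relative metric and the Darboux tensor\<close>

definition "h11_1 = (\<lambda>u v. d1 u * m u + d u * deriv m u - deriv k u * ((d u)\<^sup>2 + v\<^sup>2)
  - 2 * k u * d u * d1 u - deriv d1 u * v)"
definition "h11_2 = (\<lambda>u v. - 2 * k u * v - d1 u)"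

lemma h11_derivs:
  assumes "u \<in> I"
  shows "((\<lambda>t. h11 t v) has_real_derivative h11_1 u v) (at u)"
    "((\<lambda>t. h11 u t) has_real_derivative h11_2 u v) (at v)"
    "((\<lambda>t. h11_2 t v) has_real_derivative - 2 * deriv k u * v - deriv d1 u) (at u)"
    "((\<lambda>t. h11_2 u t) has_real_derivative - 2 * k u) (at v)"
    "((\<lambda>t. h11_1 u t) has_real_derivative - 2 * deriv k u * v - deriv d1 u) (at v)"
  unfolding h11_def h11_1_def h11_2_def
  by (auto intro!: derivative_eq_intros invariant_derivs[OF assms] d_deriv[OF assms])

abbreviation "G \<equiv> relative_metric x y"

text \<open>The raw form of the quotient rule is kept, even with its factor \<open>0\<close>, to
  match that rule literally.\<close>

definition "E_1 = (\<lambda>u v. (h11_1 u v * p u v - h11 u v * p1 u v) / (p u v * p u v))"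
definition "E_2 = (\<lambda>u v. (h11_2 u v * p u v - h11 u v * p2 u v) / (p u v * p u v))"
definition "F_1 = (\<lambda>u v. (d1 u * p u v - d u * p1 u v) / (p u v * p u v))"
definition "F_2 = (\<lambda>u v. (0 * p u v - d u * p2 u v) / (p u v * p u v))"

sublocale null_metric I G "\<lambda>u v. h11 u v / p u v" "\<lambda>u v. d u / p u v" E_1 E_2 F_1 F_2
proof
  fix u v assume u: "u \<in> I"
  note p = p_nz[OF u]
  show "((\<lambda>t. h11 t v / p t v) has_real_derivative E_1 u v) (at u)"
    unfolding E_1_def by (rule DERIV_divide[OF h11_derivs(1)[OF u] p_derivs(1)[OF u] p])
  show "((\<lambda>t. h11 u t / p u t) has_real_derivative E_2 u v) (at v)"
    unfolding E_2_def by (rule DERIV_divide[OF h11_derivs(2)[OF u] p_derivs(2)[OF u] p])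
  show "((\<lambda>t. d t / p t v) has_real_derivative F_1 u v) (at u)"
    unfolding F_1_def by (rule DERIV_divide[OF d_deriv[OF u] p_derivs(1)[OF u] p])
  show "((\<lambda>t. d u / p u t) has_real_derivative F_2 u v) (at v)"
    unfolding F_2_def by (rule DERIV_divide[OF DERIV_const p_derivs(2)[OF u] p])
qed (simp_all add: open_I relative_metric p_nz d_nz)

text \<open>The mixed derivative of \<open>F\<close> is taken as the u-derivative of
  \<open>F_2\<close>, so \<open>p12\<close> and \<open>p22\<close> are the only second derivatives
  of \<open>p\<close> that occur.\<close>

lemma curvature_p:
  assumes u: "u \<in> I"
  shows "relative_metric_curvature x y u v =
    p12 u v / d u - p1 u v * p2 u v / (d u * p u v)
    + (- 2 * k u * (p u v)\<^sup>2 - h11_2 u v * p2 u v * p u v - h11 u v * p22 u v * p u v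
       + h11 u v * (p2 u v)\<^sup>2) / (2 * (d u)\<^sup>2 * p u v)"
proof -
  note p = p_nz[OF u, of v] and d = d_nz[OF u]
  note D = p_derivs[OF u, of v] d_deriv[OF u] h11_derivs(2,4)[OF u, of v]
  have F: "((\<lambda>t. F_2 t v) has_real_derivative
      (- (d1 u * p2 u v + d u * p12 u v) * p u v + 2 * d u * p1 u v * p2 u v) / p u v ^ 3) (at u)"
    unfolding F_2_def using p
    by (auto intro!: derivative_eq_intros D simp: field_simps power3_eq_cube)
  have E: "((\<lambda>t. E_2 u t) has_real_derivative
      ((- 2 * k u * p u v - h11 u v * p22 u v) * p u v
       - 2 * (h11_2 u v * p u v - h11 u v * p2 u v) * p2 u v) / p u v ^ 3) (at v)"
    unfolding E_2_def using p
    by (auto intro!: derivative_eq_intros D simp: field_simps power3_eq_cube)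
  show ?thesis
    unfolding relative_metric_curvature_def curvature[OF u F E] F_1_def F_2_def E_2_def
    using p d by (simp add: field_simps power2_eq_square power3_eq_cube)
qed

section \<open>The Darboux tensor and the Pick invariant\<close>

abbreviation "T \<equiv> cov_deriv1 G (\<lambda>i. pd i x)"

lemma T:
  assumes "u \<in> I"
  shows "T 1 1 u v = x11 u v - christoffel G 1 1 1 u v *\<^sub>R x1 u v - christoffel G 2 1 1 u v *\<^sub>R e u"
    "T 1 2 u v = n u - christoffel G 2 1 2 u v *\<^sub>R e u"
    "T 2 1 u v = n u - christoffel G 2 1 2 u v *\<^sub>R e u"
    "T 2 2 u v = - christoffel G 2 2 2 u v *\<^sub>R e u"
  using christoffel(2-4,6,7)[OF assms, of v]
  by (simp_all add: cov_deriv1_def pd_x[OF assms] pd_pd_x[OF assms] sum_2)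

text \<open>\<open>N\<close> is orthogonal to \<open>x1\<close> and \<open>e\<close>, so the
  Christoffel terms drop out and the coefficients w h_ij remain.\<close>

lemma N_T:
  assumes "u \<in> I"
  shows "N u v \<bullet> T 1 1 u v = h11 u v" "N u v \<bullet> T 1 2 u v = d u" "N u v \<bullet> T 2 1 u v = d u"
    "N u v \<bullet> T 2 2 u v = 0"
  by (simp_all add: T[OF assms] inner_diff_right N_inner[OF assms])

text \<open>Existence suffices, because the derivatives will multiply tangent vectors, which
  \<open>N\<close> annihilates. The u-derivatives of the symbols with lower indices 1, 1 would occur
  only in A_111.\<close>

lemma christoffel_derivs:
  assumes u: "u \<in> I"
  shows "\<exists>D. ((\<lambda>t. christoffel G 1 1 1 u t) has_real_derivative D) (at v)"
    "\<exists>D. ((\<lambda>t. christoffel G 2 1 1 u t) has_real_derivative D) (at v)"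
    "\<exists>D. ((\<lambda>t. christoffel G 2 1 2 u t) has_real_derivative D) (at v)"
    "\<exists>D. ((\<lambda>t. christoffel G 2 2 2 u t) has_real_derivative D) (at v)"
    "\<exists>D. ((\<lambda>t. christoffel G 2 1 2 t v) has_real_derivative D) (at u)"
    "\<exists>D. ((\<lambda>t. christoffel G 2 2 2 t v) has_real_derivative D) (at u)"
proof -
  note p = p_nz[OF u] and d = d_nz[OF u]
  note differentiableI = real_differentiable_def[THEN iffD2, OF exI]
  note D = p_derivs[OF u, THEN differentiableI] p1_deriv_v[OF u, THEN differentiableI]
    h11_derivs[OF u, THEN differentiableI] d_deriv[OF u, THEN differentiableI]
  note simps = christoffel[OF u] E_1_def E_2_def F_1_def F_2_def
  show "\<exists>D. ((\<lambda>t. christoffel G 1 1 1 u t) has_real_derivative D) (at v)"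
    "\<exists>D. ((\<lambda>t. christoffel G 2 1 1 u t) has_real_derivative D) (at v)"
    "\<exists>D. ((\<lambda>t. christoffel G 2 1 2 u t) has_real_derivative D) (at v)"
    "\<exists>D. ((\<lambda>t. christoffel G 2 2 2 u t) has_real_derivative D) (at v)"
    unfolding real_differentiable_def[symmetric] simps
    by (intro derivative_intros D; simp add: p d)+
  \<comment> \<open>Along u the closed forms hold only on the open set \<open>I\<close>, so
    differentiability is transferred locally.\<close>
  have *: "\<exists>D. (f has_real_derivative D) (at u)"
    if "g differentiable (at u)" "\<And>t. t \<in> I \<Longrightarrow> f t = g t" for f g :: "real \<Rightarrow> real"
    using that has_field_derivative_transform_within_open[OF _ open_I u]
    unfolding real_differentiable_def by metis
  show "\<exists>D. ((\<lambda>t. christoffel G 2 1 2 t v) has_real_derivative D) (at u)"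
    by (rule *[OF _ christoffel(6)], unfold E_2_def) (intro derivative_intros D; simp add: p d)
  show "\<exists>D. ((\<lambda>t. christoffel G 2 2 2 t v) has_real_derivative D) (at u)"
    by (rule *[OF _ christoffel(8)], unfold F_2_def) (intro derivative_intros D; simp add: p d)
qed

text \<open>The unknown derivatives \<open>D1\<close> to \<open>D6\<close> multiply
  \<open>x1\<close>, with v-derivative \<open>n\<close>, or \<open>e\<close>. What survives is a
  Christoffel symbol times N.n = \<delta> and, where present, N.n' = -\<kappa> v.\<close>

lemma N_pd_T:
  assumes u: "u \<in> I"
  shows "N u v \<bullet> pd 2 (T 1 1) u v = - k u * v - christoffel G 1 1 1 u v * d u"
    "N u v \<bullet> pd 1 (T 1 2) u v = - k u * v - christoffel G 2 1 2 u v * d u"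
    "N u v \<bullet> pd 1 (T 2 1) u v = - k u * v - christoffel G 2 1 2 u v * d u"
    "N u v \<bullet> pd 1 (T 2 2) u v = - christoffel G 2 2 2 u v * d u"
    "N u v \<bullet> pd 2 (T 1 2) u v = 0" "N u v \<bullet> pd 2 (T 2 1) u v = 0"
    "N u v \<bullet> pd 2 (T 2 2) u v = 0"
proof -
  note const = has_vector_derivative_const[where c = "e u"]
    and e = curve_derivs(4)[OF u] and n = curve_derivs(5)[OF u]
  note simps = inner_diff_right inner_add_right N_inner[OF u]
  obtain D1 where D1: "((\<lambda>t. christoffel G 1 1 1 u t) has_real_derivative D1) (at v)"
    using christoffel_derivs(1)[OF u] by blast
  obtain D2 where D2: "((\<lambda>t. christoffel G 2 1 1 u t) has_real_derivative D2) (at v)"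
    using christoffel_derivs(2)[OF u] by blast
  obtain D3 where D3: "((\<lambda>t. christoffel G 2 1 2 u t) has_real_derivative D3) (at v)"
    using christoffel_derivs(3)[OF u] by blast
  obtain D4 where D4: "((\<lambda>t. christoffel G 2 2 2 u t) has_real_derivative D4) (at v)"
    using christoffel_derivs(4)[OF u] by blast
  obtain D5 where D5: "((\<lambda>t. christoffel G 2 1 2 t v) has_real_derivative D5) (at u)"
    using christoffel_derivs(5)[OF u] by blast
  obtain D6 where D6: "((\<lambda>t. christoffel G 2 2 2 t v) has_real_derivative D6) (at u)"
    using christoffel_derivs(6)[OF u] by blast
  have x11: "((\<lambda>t. x11 u t) has_vector_derivative n1 u) (at v)"
    unfolding x11_def by (rule line_deriv)
  show "N u v \<bullet> pd 2 (T 1 1) u v = - k u * v - christoffel G 1 1 1 u v * d u"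
    by (subst pd_2_eqI[OF _ has_vector_derivative_diff[OF has_vector_derivative_diff[OF x11
          has_vector_derivative_scaleR[OF D1 x1_deriv(2)[OF u]]] has_vector_derivative_scaleR[OF D2 const]]])
      (simp_all add: simps T u)
  show "N u v \<bullet> pd 2 (T 1 2) u v = 0"
    by (subst pd_2_eqI[OF _ has_vector_derivative_diff[OF has_vector_derivative_const
            has_vector_derivative_scaleR[OF D3 const]]])
      (simp_all add: simps T u)
  show "N u v \<bullet> pd 2 (T 2 1) u v = 0"
    by (subst pd_2_eqI[OF _ has_vector_derivative_diff[OF has_vector_derivative_const
            has_vector_derivative_scaleR[OF D3 const]]])
      (simp_all add: simps T u)
  show "N u v \<bullet> pd 2 (T 2 2) u v = 0"
    by (subst pd_2_eqI[OF _ has_vector_derivative_scaleR[OF DERIV_minus[OF D4] const]])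
      (simp_all add: simps T u)
  show "N u v \<bullet> pd 1 (T 1 2) u v = - k u * v - christoffel G 2 1 2 u v * d u"
    by (subst pd_1_eqI[OF open_I u _ has_vector_derivative_diff[OF n
            has_vector_derivative_scaleR[OF D5 e]]])
      (simp_all add: simps T u)
  show "N u v \<bullet> pd 1 (T 2 1) u v = - k u * v - christoffel G 2 1 2 u v * d u"
    by (subst pd_1_eqI[OF open_I u _ has_vector_derivative_diff[OF n
            has_vector_derivative_scaleR[OF D5 e]]])
      (simp_all add: simps T u)
  show "N u v \<bullet> pd 1 (T 2 2) u v = - christoffel G 2 2 2 u v * d u"
    by (subst pd_1_eqI[OF open_I u _ has_vector_derivative_scaleR[OF DERIV_minus[OF D6] e]])
      (simp_all add: simps T u)
qed

text \<open>The root w cancels, since \<xi>/q = N/p.\<close>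

lemma darboux_tensor:
  assumes u: "u \<in> I"
  shows "darboux_tensor x y i j l u v = (N u v \<bullet> pd l (T j i) u v
     - (\<Sum>a\<in>UNIV. christoffel G a l j u v * (N u v \<bullet> T a i u v))
     - (\<Sum>a\<in>UNIV. christoffel G a l i u v * (N u v \<bullet> T j a u v))) / p u v"
  using w_pos[OF u, of v] p_nz[OF u, of v]
  by (simp add: darboux_tensor_def support[OF u] unit_normal_eq[OF u] cov_deriv2_def inner_diff_right
      inner_add_right sum_2 field_simps)

text \<open>The total symmetry of the tensor is not visible in its definition; here it emerges by
  computing each component separately.\<close>

lemma darboux_components:
  fixes u v :: real
  assumes u: "u \<in> I"
  defines "a \<equiv> (2 * d u * p1 u v - d1 u * p u v + h11 u v * p2 u v) / (2 * (p u v)\<^sup>2)"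
    and "b \<equiv> d u * p2 u v / (p u v)\<^sup>2"
  shows "darboux_tensor x y 1 1 2 u v = a" "darboux_tensor x y 1 2 1 u v = a"
    "darboux_tensor x y 2 1 1 u v = a" "darboux_tensor x y 1 2 2 u v = b"
    "darboux_tensor x y 2 1 2 u v = b" "darboux_tensor x y 2 2 1 u v = b"
    "darboux_tensor x y 2 2 2 u v = 0"
  unfolding a_def b_def darboux_tensor[OF u] sum_2 N_pd_T[OF u] N_T[OF u] christoffel[OF u]
    E_2_def F_1_def F_2_def h11_2_def
  using p_nz[OF u, of v] d_nz[OF u]
  by (simp_all add: field_simps power2_eq_square)

text \<open>The inverse metric has entries g = p/\<delta> and h = -h11 p/\<delta>^2. Then b g^2 =
  p2/\<delta>, and b h reverses the sign with which h11 p2 enters a g.\<close>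

lemma pick_invariant_p:
  assumes u: "u \<in> I"
  shows "pick_invariant x y u v =
    3 * p2 u v / (2 * (d u)\<^sup>2 * p u v) * (2 * d u * p1 u v - d1 u * p u v - h11 u v * p2 u v)"
  unfolding pick_invariant_def Let_def
  using p_nz[OF u, of v] d_nz[OF u]
  by (subst cubic_norm_null_2[of "matrix_inv (G u v)", OF matrix_inv_null_2[OF relative_metric[OF u]]
      darboux_components[OF u]])
    (simp_all add: field_simps power2_eq_square)


subsection \<open>From \<open>p\<close> to \<open>q\<close>\<close>

abbreviation "q \<equiv> support_function x y"

lemma w_derivs:
  assumes "u \<in> I"
  shows "((\<lambda>t. w t v) has_real_derivative d u * d1 u / w u v) (at u)"
    "((\<lambda>t. w u t) has_real_derivative v / w u v) (at v)"
  using w_pos[OF assms, of v]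
  by (auto simp: w_def field_simps intro!: derivative_eq_intros d_deriv[OF assms])

lemma pd_q:
  assumes u: "u \<in> I"
  shows "pd 1 q u v = (p1 u v * w u v - p u v * (d u * d1 u / w u v)) / (w u v * w u v)"
    "pd 2 q u v = p2 u v / w u v - v * p u v / w u v ^ 3"
proof -
  have w: "w u v \<noteq> 0" using w_pos[OF u, of v] by simp
  note w_derivs = w_derivs[OF u, of v] and p_derivs = p_derivs[OF u, of v]
  show "pd 1 q u v = (p1 u v * w u v - p u v * (d u * d1 u / w u v)) / (w u v * w u v)"
    by (rule pd_1_real_eqI[OF open_I u _ DERIV_divide[OF p_derivs(1) w_derivs(1) w]])
      (simp add: support)
  have "pd 2 q u v = (p2 u v * w u v - p u v * (v / w u v)) / (w u v * w u v)"
    by (rule pd_2_real_eqI[OF _ DERIV_divide[OF p_derivs(2) w_derivs(2) w]])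
      (simp add: support u)
  then show "pd 2 q u v = p2 u v / w u v - v * p u v / w u v ^ 3"
    using w by (simp add: field_simps power3_eq_cube)
qed

lemma pd_pd_2_q:
  assumes u: "u \<in> I"
  shows "pd 1 (pd 2 q) u v = p12 u v / w u v - (d u * d1 u * p2 u v + v * p1 u v) / w u v ^ 3
      + 3 * v * d u * d1 u * p u v / w u v ^ 5"
    "pd 2 (pd 2 q) u v = p22 u v / w u v - (2 * v * p2 u v + p u v) / w u v ^ 3
      + 3 * v\<^sup>2 * p u v / w u v ^ 5"
proof -
  have w: "w u v \<noteq> 0" using w_pos[OF u, of v] by simp
  note D = w_derivs[OF u, of v] p_derivs[OF u, of v]
  show "pd 1 (pd 2 q) u v = p12 u v / w u v - (d u * d1 u * p2 u v + v * p1 u v) / w u v ^ 3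
      + 3 * v * d u * d1 u * p u v / w u v ^ 5"
    by (rule pd_1_real_eqI[OF open_I u, where g = "\<lambda>t. p2 t v / w t v - v * p t v / w t v ^ 3"])
      (use w in \<open>auto simp: pd_q field_simps intro!: derivative_eq_intros D simp: eval_nat_numeral\<close>)
  show "pd 2 (pd 2 q) u v = p22 u v / w u v - (2 * v * p2 u v + p u v) / w u v ^ 3
      + 3 * v\<^sup>2 * p u v / w u v ^ 5"
    by (rule pd_2_real_eqI[where g = "\<lambda>t. p2 u t / w u t - t * p u t / w u t ^ 3"])
      (use w u in \<open>auto simp: pd_q field_simps intro!: derivative_eq_intros D simp: eval_nat_numeral\<close>)
qed

text \<open>The derivatives of q = p/w are solved for those of \<open>p\<close>; the results are the
  product rule for p = w q.\<close>

lemma p_eq_q: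
  assumes u: "u \<in> I"
  shows "p u v = w u v * q u v"
    "p1 u v = w u v * pd 1 q u v + d u * d1 u * q u v / w u v"
    "p2 u v = w u v * pd 2 q u v + v * q u v / w u v"
    "p12 u v = w u v * pd 1 (pd 2 q) u v + (d u * d1 u * pd 2 q u v + v * pd 1 q u v) / w u v
       - v * d u * d1 u * q u v / w u v ^ 3"
    "p22 u v = w u v * pd 2 (pd 2 q) u v + 2 * v * pd 2 q u v / w u v + (d u)\<^sup>2 * q u v / w u v ^ 3"
proof -
  have w: "w u v \<noteq> 0" using w_pos[OF u, of v] by simp
  note simps = support[OF u] pd_q[OF u] pd_pd_2_q[OF u]
  show "p u v = w u v * q u v" "p1 u v = w u v * pd 1 q u v + d u * d1 u * q u v / w u v"
    "p2 u v = w u v * pd 2 q u v + v * q u v / w u v"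
    "p12 u v = w u v * pd 1 (pd 2 q) u v + (d u * d1 u * pd 2 q u v + v * pd 1 q u v) / w u v
       - v * d u * d1 u * q u v / w u v ^ 3"
    using w by (simp_all add: simps field_simps eval_nat_numeral)
  \<comment> \<open>The second v-derivative of w is (w^2 - v^2)/w^3, which is \<delta>^2/w^3 by
    \<open>w_power2\<close>.\<close>
  show "p22 u v = w u v * pd 2 (pd 2 q) u v + 2 * v * pd 2 q u v / w u v + (d u)\<^sup>2 * q u v / w u v ^ 3"
    using w by (simp add: simps field_simps) (use w_power2[of u v] in algebra)
qed

end

text \<open>Values of the functions and of their derivatives at one point are treated as independent
  reals. After clearing denominators, each claim is a polynomial identity modulo w^2 = \<delta>^2 +
  v^2.\<close>

lemma invariants_rescale:
  fixes d d1 k l v w Q q1 q2 q12 q22 :: real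
  assumes w2: "w\<^sup>2 = d\<^sup>2 + v\<^sup>2" and nz: "w \<noteq> 0" "d \<noteq> 0" "Q \<noteq> 0"
  defines "h \<equiv> d * (d * l) - k * (d\<^sup>2 + v\<^sup>2) - d1 * v"
    and "p \<equiv> w * Q" and "p1 \<equiv> w * q1 + d * d1 * Q / w" and "p2 \<equiv> w * q2 + v * Q / w"
    and "p12 \<equiv> w * q12 + (d * d1 * q2 + v * q1) / w - v * d * d1 * Q / w ^ 3"
    and "p22 \<equiv> w * q22 + 2 * v * q2 / w + d\<^sup>2 * Q / w ^ 3"
  shows "3 * p2 / (2 * d\<^sup>2 * p) * (2 * d * p1 - d1 * p - h * p2) =
      3 * (w^2 * q2 + v * Q) / (2 * d^2 * w^3 * Q) *
        (w^2 * (k * Q * v + 2 * d * q1 + q2 * (k * w^2 + d1 * v - d^2 * l))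
          - d^2 * Q * (l * v - d1))" (is ?J)
    and "p12 / d - k * (p - v * p2) / d\<^sup>2 - h * p22 / (2 * d\<^sup>2) =
      1 / (2 * d^2 * w^3) *
        (- (d^2 * Q * (k * w^2 + d1 * v + d^2 * l))
          + 2 * w^2 * q2 * ((2 * k * v + d1) * w^2 - d^2 * l * v)
          + w^4 * q22 * (k * w^2 + d1 * v - d^2 * l)
          + 2 * d * v * w^2 * q1 + 2 * d * w^4 * q12)" (is ?H)
    and "p12 / d - p1 * p2 / (d * p)
      + (- 2 * k * p\<^sup>2 - (- 2 * k * v - d1) * p2 * p - h * p22 * p + h * p2\<^sup>2) / (2 * d\<^sup>2 * p) =
      1 / (2 * d^2 * w^3 * Q) *
        (Q^2 * (- k * w^4 + d^2 * (l * v^2 - 2 * d1 * v - d^2 * l))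
          + w^4 * Q * q2 * (2 * k * v + d1)
          + w^4 * (k * w^2 + d1 * v - d^2 * l) * (Q * q22 - q2^2)
          - 2 * d * w^4 * q1 * q2 + 2 * d * w^4 * Q * q12)" (is ?S)
proof -
  \<comment> \<open>The bracket \<kappa> w^2 + \<delta>' v - \<delta>^2 \<lambda> that recurs in the
    results is -h.\<close>
  have h: "h = - (k * w\<^sup>2 + d1 * v - d\<^sup>2 * l)"
    unfolding h_def w2[symmetric] by (simp add: power2_eq_square algebra_simps)
  note simps = p_def p1_def p2_def p12_def p22_def h
  show ?J
    unfolding simps using nz by (simp add: field_simps) (use w2 in algebra)
  show ?H
    unfolding simps using nz by (simp add: field_simps) (use w2 in algebra)
  show ?S
    unfolding simps using nz by (simp add: field_simps) (use w2 in algebra)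
qed

theorem mainTheorem5:
  fixes I :: "real set" and s e :: "real \<Rightarrow> real^3" and y :: "real \<Rightarrow> real \<Rightarrow> real^3"
    and \<Lambda> :: "real \<Rightarrow> real"
  defines "x \<equiv> ruled_surface s e"
  defines "q \<equiv> support_function x y"
  assumes ruled: "skew_ruled_surface I s e"
    and lambda: "is_ruled_lambda I s e \<Lambda>"
    and normalization: "relative_normalization (I \<times> UNIV) x y"
  shows "\<forall>u\<in>I. \<forall>v.
    let \<delta> = ruled_delta s e u; \<delta>' = deriv (ruled_delta s e) u;
        \<kappa> = ruled_kappa e u; l = \<Lambda> u; w = sqrt (\<delta>^2 + v^2);
        Q = q u v; q1 = pd 1 q u v; q2 = pd 2 q u v;
        q12 = pd 1 (pd 2 q) u v; q22 = pd 2 (pd 2 q) u v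
    in
      pick_invariant x y u v =
        3 * (w^2 * q2 + v * Q) / (2 * \<delta>^2 * w^3 * Q) *
          (w^2 * (\<kappa> * Q * v + 2 * \<delta> * q1 + q2 * (\<kappa> * w^2 + \<delta>' * v - \<delta>^2 * l))
            - \<delta>^2 * Q * (l * v - \<delta>'))
    \<and> relative_mean_curvature x y u v =
        1 / (2 * \<delta>^2 * w^3) *
          (- (\<delta>^2 * Q * (\<kappa> * w^2 + \<delta>' * v + \<delta>^2 * l))
            + 2 * w^2 * q2 * ((2 * \<kappa> * v + \<delta>') * w^2 - \<delta>^2 * l * v)
            + w^4 * q22 * (\<kappa> * w^2 + \<delta>' * v - \<delta>^2 * l)
            + 2 * \<delta> * v * w^2 * q1 + 2 * \<delta> * w^4 * q12)
    \<and> relative_metric_curvature x y u v =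
        1 / (2 * \<delta>^2 * w^3 * Q) *
          (Q^2 * (- \<kappa> * w^4 + \<delta>^2 * (l * v^2 - 2 * \<delta>' * v - \<delta>^2 * l))
            + w^4 * Q * q2 * (2 * \<kappa> * v + \<delta>')
            + w^4 * (\<kappa> * w^2 + \<delta>' * v - \<delta>^2 * l) * (Q * q22 - q2^2)
            - 2 * \<delta> * w^4 * q1 * q2 + 2 * \<delta> * w^4 * Q * q12)"
    (is "\<forall>u\<in>I. \<forall>v. ?formulas u v")
proof (intro ballI allI)
  fix u v assume u: "u \<in> I"
  interpret S: normalized_skew_ruled_surface I s e y \<Lambda>
    using ruled lambda normalization unfolding x_def by unfold_locales
  have w: "S.w u v \<noteq> 0" and Q: "q u v \<noteq> 0"
    using S.w_pos[OF u, of v] S.p_nz[OF u, of v] by (simp_all add: q_def x_def S.support u)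
  \<comment> \<open>With \<delta>' rewritten to \<open>d1\<close> and \<open>m\<close> to \<delta>
    \<lambda>, the claims become instances of the algebraic identities.\<close>
  show "?formulas u v"
    unfolding Let_def S.ruled_delta_eq S.ruled_kappa_eq DERIV_imp_deriv[OF S.d_deriv[OF u]]
      S.w_def[THEN fun_cong, THEN fun_cong, symmetric]
      S.pick_invariant_p[OF u, folded x_def] S.mean_curvature[OF u, folded x_def]
      S.curvature_p[OF u, folded x_def] S.p_eq_q[OF u, folded x_def q_def]
      S.h11_def S.h11_2_def S.m_eq[OF u]
    by (intro conjI invariants_rescale S.w_power2 w Q S.d_nz[OF u])
qed

end
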